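(* The variety of complex $3$-dimensional binary $\mathfrak{perm}$ superalgebras of type $(1,2)$ has dimension $4$ and has exactly $8$ irreducible components: $\overline{\mathcal{O}(\mathrm{R}_{04}^{\alpha})},\ \overline{\mathcal{O}(\mathrm{R}_{07}^{\alpha})},\ \overline{\mathcal{O}(\mathrm{R}_{09})},\ \overline{\mathcal{O}(\mathrm{R}_{15})},\ \overline{\mathcal{O}(\mathrm{R}_{17})},\ \overline{\mathcal{O}(\mathrm{R}_{19})},\ \overline{\mathcal{O}(\mathrm{R}_{22})},\ \overline{\mathcal{O}(\mathrm{R}_{24})}$. In particular, exactly $6$ superalgebras are rigid in this variety.
   Context: All algebras are over $\mathbb{C}$. A superalgebra is a $\mathbb{Z}_2$-graded algebra $A=A_0\oplus A_1$ with $A_iA_j\subseteq A_{i+j \bmod 2}$; $|x|\in\{0,1\}$ is the degree of a homogeneous $x$. It has type $(n,m)$ if $\dim A_0=n$, $\dim A_1=m$. The associator is $(x,y,z)=(xy)z-x(yz)$. A binary $\mathfrak{perm}$ superalgebra is a superalgebra satisfying, for all homogeneous $x,y,z$: $(x,y,z)=-(-1)^{|y||z|}(x,z,y)=-(-1)^{|x||y|}(y,x,z)$ and $(xy)z+(-1)^{|x||y|+|x||z|+|y||z|}(zy)x=(-1)^{|y||z|}(xz)y+(-1)^{|x||z|+|y||z|}(zx)y$. Geometric setting: fix a graded space $V=V_0\oplus V_1$ of type $(n,m)$ with a homogeneous basis. Superalgebra structures on $V$ are even bilinear maps $\mu:V\times V\to V$, identified with their structure constants; those satisfying a given family of graded polynomial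 identities form a Zariski-closed subset (an affine variety) of this affine space. The group $GL(V_0)\times GL(V_1)$ acts by $(g*\mu)(x,y)=g\mu(g^{-1}x,g^{-1}y)$; its orbits are the isomorphism classes. $\mathcal{O}(A)$ denotes the orbit of (a structure representing) $A$ and $\overline{\mathcal{O}(A)}$ its Zariski closure; for a family $A^{\alpha}$, $\overline{\mathcal{O}(A^{\alpha})}$ denotes the closure of the union of the orbits of all $A^{\alpha}$ over the admissible parameters $\alpha$. A superalgebra is rigid if its orbit is open in the variety. The dimension of the variety is the maximal dimension of its irreducible components. Superalgebras of type $(1,2)$, in basis $e_1$ (even), $f_1,f_2$ (odd), listed by nonzero products (unlisted products are zero), $\alpha\in\mathbb{C}$: $\mathrm{R}_{04}^{\alpha}$: $f_1f_2=(\alpha+1)e_1,\ f_2f_1=(\alpha-1)e_1$; $\mathrm{R}_{07}^{\alpha}$: $e_1f_1=(1+\alpha)f_2,\ f_1e_1=(1-\alpha)f_2,\ f_1f_1=e_1$; $\mathrm{R}_{09}$: $e_1e_1=e_1,\ f_1e_1=f_1$; $\mathrm{R}_{15}$: $e_1e_1=e_1,\ e_1f_1=f_1,\ f_1e_1=f_1,\ f_2e_1=f_2$; $\mathrm{R}_{17}$: $e_1e_1=e_1,\ e_1f_1=f_1,\ f_1e_1=f_1$; $\mathrm{R}_{19}$: $e_1e_1=e_1$; $\mathrm{R}_{22}$: $e_1e_1=e_1,\ f_1e_1=f_1,\ f_2e_1=f_2$; $\mathrm{R}_{24}$: $e_1e_1=e_1,\ e_1f_1=f_1,\ f_1e_1=f_1,\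 e_1f_2=f_2,\ f_2e_1=f_2$. *)

theory Defs
  imports Complex_Main "HOL-Library.Extended_Nat"
begin

text \<open>Basis of V = V_0 + V_1 of type (1,2): index 0 = e1 (even), 1 = f1, 2 = f2 (odd).
  A superalgebra structure on V is given by its structure constants c i j k,
  meaning (basis_i)(basis_j) = sum_k c i j k basis_k.\<close>

type_synonym sstruct = "nat \<Rightarrow> nat \<Rightarrow> nat \<Rightarrow> complex"

definition par :: "nat \<Rightarrow> nat" where
  "par i = (if i = 0 then 0 else 1)"

definition StructSpace :: "sstruct set" where
  "StructSpace = {c. \<forall>i j k. c i j k \<noteq> 0 \<longrightarrow>
      i < 3 \<and> j < 3 \<and> k < 3 \<and> par k = (par i + par j) mod 2}"

inductive_set polyfun :: "(sstruct \<Rightarrow> complex) set" where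
  pf_const: "(\<lambda>c. a) \<in> polyfun"
| pf_coord: "(\<lambda>c. c i j k) \<in> polyfun"
| pf_add: "p \<in> polyfun \<Longrightarrow> q \<in> polyfun \<Longrightarrow> (\<lambda>c. p c + q c) \<in> polyfun"
| pf_mult: "p \<in> polyfun \<Longrightarrow> q \<in> polyfun \<Longrightarrow> (\<lambda>c. p c * q c) \<in> polyfun"

definition zclosed :: "sstruct set \<Rightarrow> bool" where
  "zclosed X \<longleftrightarrow> (\<exists>P \<subseteq> polyfun. X = {c \<in> StructSpace. \<forall>p\<in>P. p c = 0})"

definition zclosure :: "sstruct set \<Rightarrow> sstruct set" where
  "zclosure S = \<Inter> {X. zclosed X \<and> S \<subseteq> X}"

definition zirreducible :: "sstruct set \<Rightarrow> bool" where
  "zirreducible X \<longleftrightarrow> zclosed X \<and> X \<noteq> {} \<and>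
     (\<forall>Y1 Y2. zclosed Y1 \<and> zclosed Y2 \<and> X \<subseteq> Y1 \<union> Y2 \<longrightarrow> X \<subseteq> Y1 \<or> X \<subseteq> Y2)"

definition irr_components :: "sstruct set \<Rightarrow> sstruct set set" where
  "irr_components V = {X. X \<subseteq> V \<and> zirreducible X \<and>
      (\<forall>Y. zirreducible Y \<and> X \<subseteq> Y \<and> Y \<subseteq> V \<longrightarrow> Y = X)}"

definition zdim :: "sstruct set \<Rightarrow> enat" where
  "zdim V = Sup {enat n | n. \<exists>Z :: nat \<Rightarrow> sstruct set.
      (\<forall>i\<le>n. zirreducible (Z i) \<and> Z i \<subseteq> V) \<and> (\<forall>i<n. Z i \<subset> Z (Suc i))}"

definition smul :: "sstruct \<Rightarrow> (nat \<Rightarrow> complex) \<Rightarrow> (nat \<Rightarrow> complex) \<Rightarrow> nat \<Rightarrow> complex" where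
  "smul c x y = (\<lambda>k. \<Sum>i<3. \<Sum>j<3. x i * y j * c i j k)"

definition homog :: "nat \<Rightarrow> (nat \<Rightarrow> complex) \<Rightarrow> bool" where
  "homog d x \<longleftrightarrow> (\<forall>i. x i \<noteq> 0 \<longrightarrow> i < 3 \<and> par i = d)"

definition assoc :: "sstruct \<Rightarrow> (nat \<Rightarrow> complex) \<Rightarrow> (nat \<Rightarrow> complex) \<Rightarrow> (nat \<Rightarrow> complex) \<Rightarrow> nat \<Rightarrow> complex" where
  "assoc c x y z = (\<lambda>k. smul c (smul c x y) z k - smul c x (smul c y z) k)"

definition sg :: "nat \<Rightarrow> complex" where
  "sg n = (-1) ^ n"

definition is_binary_perm :: "sstruct \<Rightarrow> bool" where
  "is_binary_perm c \<longleftrightarrow> (\<forall>dx dy dz x y z. dx < 2 \<and> dy < 2 \<and> dz < 2 \<and>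
      homog dx x \<and> homog dy y \<and> homog dz z \<longrightarrow>
     (\<forall>k. assoc c x y z k = - sg (dy * dz) * assoc c x z y k) \<and>
     (\<forall>k. assoc c x y z k = - sg (dx * dy) * assoc c y x z k) \<and>
     (\<forall>k. smul c (smul c x y) z k + sg (dx*dy + dx*dz + dy*dz) * smul c (smul c z y) x k
          = sg (dy*dz) * smul c (smul c x z) y k + sg (dx*dz + dy*dz) * smul c (smul c z x) y k))"

definition PermVar :: "sstruct set" where
  "PermVar = {c \<in> StructSpace. is_binary_perm c}"

definition gl_pair :: "(nat \<Rightarrow> nat \<Rightarrow> complex) \<Rightarrow> (nat \<Rightarrow> nat \<Rightarrow> complex) \<Rightarrow> bool" where
  "gl_pair G H \<longleftrightarrow>
     (\<forall>i<3. \<forall>j<3. (\<Sum>k<3. G i k * H k j) = (if i = j then 1 else 0)) \<and>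
     (\<forall>i<3. \<forall>j<3. (\<Sum>k<3. H i k * G k j) = (if i = j then 1 else 0)) \<and>
     (\<forall>i<3. \<forall>j<3. par i \<noteq> par j \<longrightarrow> G i j = 0 \<and> H i j = 0)"

definition act :: "(nat \<Rightarrow> nat \<Rightarrow> complex) \<Rightarrow> (nat \<Rightarrow> nat \<Rightarrow> complex) \<Rightarrow> sstruct \<Rightarrow> sstruct" where
  "act G H c = (\<lambda>i j k. if i < 3 \<and> j < 3 \<and> k < 3 then
      (\<Sum>a<3. \<Sum>b<3. \<Sum>l<3. H a i * H b j * c a b l * G k l) else 0)"

definition orbit :: "sstruct \<Rightarrow> sstruct set" where
  "orbit c = {act G H c | G H. gl_pair G H}"

definition rigid_in :: "sstruct set \<Rightarrow> sstruct \<Rightarrow> bool" where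
  "rigid_in V c \<longleftrightarrow> c \<in> V \<and> zclosed (V - orbit c)"

definition tbl :: "((nat \<times> nat \<times> nat) \<times> complex) list \<Rightarrow> sstruct" where
  "tbl xs = (\<lambda>i j k. case map_of xs (i, j, k) of Some v \<Rightarrow> v | None \<Rightarrow> 0)"

definition R04 :: "complex \<Rightarrow> sstruct" where
  "R04 \<alpha> = tbl [((1,2,0), \<alpha> + 1), ((2,1,0), \<alpha> - 1)]"
definition R07 :: "complex \<Rightarrow> sstruct" where
  "R07 \<alpha> = tbl [((0,1,2), 1 + \<alpha>), ((1,0,2), 1 - \<alpha>), ((1,1,0), 1)]"
definition R09 :: sstruct where
  "R09 = tbl [((0,0,0), 1), ((1,0,1), 1)]"
definition R15 :: sstruct where
  "R15 = tbl [((0,0,0), 1), ((0,1,1), 1), ((1,0,1), 1), ((2,0,2), 1)]"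
definition R17 :: sstruct where
  "R17 = tbl [((0,0,0), 1), ((0,1,1), 1), ((1,0,1), 1)]"
definition R19 :: sstruct where
  "R19 = tbl [((0,0,0), 1)]"
definition R22 :: sstruct where
  "R22 = tbl [((0,0,0), 1), ((1,0,1), 1), ((2,0,2), 1)]"
definition R24 :: sstruct where
  "R24 = tbl [((0,0,0), 1), ((0,1,1), 1), ((1,0,1), 1), ((0,2,2), 1), ((2,0,2), 1)]"

end

(*
  Write a structure as (a, L, M, B) with e e = a e, e f = L f, f e = M f, f g = B(f, g) e.

  If a is nonzero, the identities force B = 0 and make L / a, M / a commuting idempotents with
  L M = a L; counting the simultaneous eigenvectors gives six orbits, whose closures are images of
  affine 4-space.  They are separated by the linear form 3 tr L + tr M, which on the locus with a
  nonzero takes six distinct multiples of a; so each of these orbits is open.  If a = 0, either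
  L = M = 0 and B is arbitrary, or L and M are multiples of a single square-zero map N and B is a
  multiple of the square of a linear form with the kernel of N.  These two families are the closures
  of the orbits of R04 and R07; both are irreducible, and on each an orbit is cut out inside a proper
  closed subset by an invariant, so none of their points is rigid.

  Dimension: if Z_0, ..., Z_5 is a strict chain of irreducible closed sets, choose g_i vanishing on
  Z_i but not on Z_(i+1).  Since one may divide by g_i on Z_(i+1), the monomials in g_0, ..., g_4 are
  linearly independent on Z_5.  Pulled back along a dominant polynomial map from affine 4-space, too
  many of them live in too small a space of polynomials.
*)

theory Submission
  imports Defs "HOL-Computational_Algebra.Polynomial"
begin

section \<open>Polynomial functions on affine space\<close>

text \<open>Why six orbits: a common odd eigenvector has a left and a right eigenvalue in {0, a},
  and \<open>L M = a L\<close> excludes left a with right 0. Three pairs remain, and there are six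
  multisets of two of them.

  Every closure is handled as the closure of the image of a polynomial map on affine space. Such an
  image is irreducible, and its closure does not change when the zeros of a nonzero polynomial are
  removed from the source. So for \<open>R04\<close> and \<open>R07\<close> only generic parameters
  have to be matched with an orbit.

  \<open>zdim\<close> refers to arbitrary chains of irreducible closed sets, so the upper bound
  needs an argument that uses nothing about the sets except irreducibility. With exponents at most N
  there are (N+1)^5 monomials, while their pullbacks have degree O(N) in each of four variables and
  so lie in a space of dimension O(N^4). The number of variables is decisive: \<open>nilp\<close> is
  written with five parameters and must be normalised to four.\<close>

inductive_set mpf :: "((nat \<Rightarrow> complex) \<Rightarrow> complex) set" where
  mpf_const: "(\<lambda>x. a) \<in> mpf"
| mpf_coord: "(\<lambda>x. x i) \<in> mpf"
| mpf_add: "p \<in> mpf \<Longrightarrow> q \<in> mpf \<Longrightarrow> (\<lambda>x. p x + q x) \<in> mpf"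
| mpf_mult: "p \<in> mpf \<Longrightarrow> q \<in> mpf \<Longrightarrow> (\<lambda>x. p x * q x) \<in> mpf"

lemma mpf_uminus: "p \<in> mpf \<Longrightarrow> (\<lambda>x. - p x) \<in> mpf"
  using mpf_mult[OF mpf_const[of "-1"]] by simp

lemma mpf_diff: "p \<in> mpf \<Longrightarrow> q \<in> mpf \<Longrightarrow> (\<lambda>x. p x - q x) \<in> mpf"
  using mpf_add[OF _ mpf_uminus] by simp

lemma mpf_power: "p \<in> mpf \<Longrightarrow> (\<lambda>x. p x ^ n) \<in> mpf"
  by (induction n) (auto intro: mpf_const mpf_mult)

lemmas mpf_intros = mpf_const mpf_coord mpf_add mpf_mult mpf_uminus mpf_diff mpf_power

lemma mpf_line:
  "q \<in> mpf \<Longrightarrow> \<exists>P. \<forall>t. q (\<lambda>i. x i + t * (y i - x i)) = poly P t"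
proof (induction rule: mpf.induct)
  case (mpf_const a)
  show ?case by (rule exI[of _ "[:a:]"]) simp
next
  case (mpf_coord i)
  show ?case by (rule exI[of _ "[:x i, y i - x i:]"]) simp
next
  case (mpf_add p q)
  then show ?case by (metis poly_add)
next
  case (mpf_mult p q)
  then show ?case by (metis poly_mult)
qed

text \<open>On the line through \<open>x\<close> and \<open>y\<close> both restrictions are nonzero
  univariate polynomials (at t = 0 and t = 1), so their product has a non-root. This is the source
  of irreducibility for all parametrised families.\<close>

lemma mpf_domain:
  assumes "p \<in> mpf" "q \<in> mpf" "p x \<noteq> 0" "q y \<noteq> 0"
  shows "\<exists>z. p z \<noteq> 0 \<and> q z \<noteq> 0"
proof -
  obtain P where P: "\<And>t. p (\<lambda>i. x i + t * (y i - x i)) = poly P t"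
    using mpf_line[OF assms(1)] by blast
  obtain Q where Q: "\<And>t. q (\<lambda>i. x i + t * (y i - x i)) = poly Q t"
    using mpf_line[OF assms(2)] by blast
  have "poly P 0 \<noteq> 0" "poly Q 1 \<noteq> 0"
    using P[of 0] Q[of 1] assms by auto
  hence "P * Q \<noteq> 0" by auto
  then obtain t where "poly (P * Q) t \<noteq> 0"
    using poly_all_0_iff_0 by blast
  thus ?thesis by (metis P Q poly_mult mult_eq_0_iff)
qed

definition polymap :: "((nat \<Rightarrow> complex) \<Rightarrow> sstruct) \<Rightarrow> bool" where
  "polymap g \<longleftrightarrow> (\<forall>x. g x \<in> StructSpace) \<and> (\<forall>i j k. (\<lambda>x. g x i j k) \<in> mpf)"

lemma polymap_comp:
  assumes "polymap g" "p \<in> polyfun"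
  shows "(\<lambda>x. p (g x)) \<in> mpf"
  using assms(2)
  by (induction rule: polyfun.induct) (use assms(1) in \<open>auto simp: polymap_def intro: mpf_intros\<close>)

section \<open>The Zariski topology\<close>

lemma pf_uminus: "p \<in> polyfun \<Longrightarrow> (\<lambda>x. - p x) \<in> polyfun"
  using pf_mult[OF pf_const[of "-1"]] by simp

lemma pf_diff: "p \<in> polyfun \<Longrightarrow> q \<in> polyfun \<Longrightarrow> (\<lambda>x. p x - q x) \<in> polyfun"
  using pf_add[OF _ pf_uminus] by simp

lemma pf_sum: "(\<And>i. i \<in> I \<Longrightarrow> p i \<in> polyfun) \<Longrightarrow> (\<lambda>x. \<Sum>i\<in>I. p i x) \<in> polyfun"
  by (induction I rule: infinite_finite_induct) (auto intro: pf_const pf_add)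

lemma pf_power: "p \<in> polyfun \<Longrightarrow> (\<lambda>x. p x ^ n) \<in> polyfun"
  by (induction n) (auto intro: pf_const pf_mult)

lemmas pf_intros = pf_const pf_coord pf_add pf_mult pf_uminus pf_diff pf_sum pf_power

lemma zclosed_subset: "zclosed X \<Longrightarrow> X \<subseteq> StructSpace"
  by (auto simp: zclosed_def)

lemma zclosed_hypersurface:
  assumes "zclosed X" "p \<in> polyfun"
  shows "zclosed {c \<in> X. p c = 0}"
proof -
  obtain P where P: "P \<subseteq> polyfun" "X = {c \<in> StructSpace. \<forall>p\<in>P. p c = 0}"
    using assms by (auto simp: zclosed_def)
  show ?thesis unfolding zclosed_def
    by (rule exI[of _ "insert p P"]) (use P assms in auto)
qed

lemma zclosed_StructSpace: "zclosed StructSpace"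
  unfolding zclosed_def by (rule exI[of _ "{}"]) auto

lemma zclosed_Un:
  assumes "zclosed X" "zclosed Y"
  shows "zclosed (X \<union> Y)"
proof -
  obtain P where P: "P \<subseteq> polyfun" "X = {c \<in> StructSpace. \<forall>p\<in>P. p c = 0}"
    using assms by (auto simp: zclosed_def)
  obtain Q where Q: "Q \<subseteq> polyfun" "Y = {c \<in> StructSpace. \<forall>p\<in>Q. p c = 0}"
    using assms by (auto simp: zclosed_def)
  let ?R = "{(\<lambda>c. p c * q c) | p q. p \<in> P \<and> q \<in> Q}"
  have "?R \<subseteq> polyfun" using P Q by (auto intro: pf_mult)
  moreover have "X \<union> Y = {c \<in> StructSpace. \<forall>r\<in>?R. r c = 0}"
  proof (intro set_eqI iffI)
    fix c assume c: "c \<in> {c \<in> StructSpace. \<forall>r\<in>?R. r c = 0}"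
    have "p c = 0 \<or> q c = 0" if "p \<in> P" "q \<in> Q" for p q
    proof -
      have "(\<lambda>c. p c * q c) \<in> ?R" using that by blast
      hence "p c * q c = 0" using c by fastforce
      thus ?thesis by simp
    qed
    hence "(\<forall>p\<in>P. p c = 0) \<or> (\<forall>q\<in>Q. q c = 0)" by blast
    thus "c \<in> X \<union> Y" using c unfolding P(2) Q(2) by blast
  qed (use P Q in auto)
  ultimately show ?thesis unfolding zclosed_def by blast
qed

lemma zclosed_Union:
  "finite F \<Longrightarrow> F \<noteq> {} \<Longrightarrow> (\<And>X. X \<in> F \<Longrightarrow> zclosed X) \<Longrightarrow> zclosed (\<Union>F)"
  by (induction F rule: finite_ne_induct) (auto intro: zclosed_Un)

lemma zclosure_least: "zclosed X \<Longrightarrow> S \<subseteq> X \<Longrightarrow> zclosure S \<subseteq> X"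
  by (auto simp: zclosure_def)

lemma zclosure_superset: "S \<subseteq> zclosure S"
  by (auto simp: zclosure_def)

lemma zclosure_eq:
  assumes "S \<subseteq> StructSpace"
  shows "zclosure S = {c \<in> StructSpace. \<forall>p\<in>polyfun. (\<forall>s\<in>S. p s = 0) \<longrightarrow> p c = 0}"
    (is "_ = ?R")
proof
  let ?P = "{p \<in> polyfun. \<forall>s\<in>S. p s = 0}"
  have "?R = {c \<in> StructSpace. \<forall>p\<in>?P. p c = 0}" by auto
  hence "zclosed ?R" unfolding zclosed_def by (intro exI[of _ ?P]) auto
  thus "zclosure S \<subseteq> ?R" using assms by (intro zclosure_least) auto
  show "?R \<subseteq> zclosure S"
    unfolding zclosure_def zclosed_def using assms by auto
qed

lemma zclosed_zclosure:
  assumes "S \<subseteq> StructSpace"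
  shows "zclosed (zclosure S)"
  unfolding zclosure_eq[OF assms] zclosed_def
  by (rule exI[of _ "{p \<in> polyfun. \<forall>s\<in>S. p s = 0}"]) auto

lemma zclosure_mono:
  assumes "S \<subseteq> T" "T \<subseteq> StructSpace"
  shows "zclosure S \<subseteq> zclosure T"
  by (rule zclosure_least) (use assms zclosed_zclosure zclosure_superset in blast)+

lemma zclosure_vanish:
  assumes "p \<in> polyfun" "S \<subseteq> StructSpace" "\<And>c. c \<in> S \<Longrightarrow> p c = 0" "c \<in> zclosure S"
  shows "p c = 0"
  using assms zclosure_eq[OF assms(2)] by auto

lemma range_polymap: "polymap g \<Longrightarrow> g ` A \<subseteq> StructSpace"
  by (auto simp: polymap_def)

lemma zirreducible_polymap:
  assumes "polymap g"
  shows "zirreducible (zclosure (range g))"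
  unfolding zirreducible_def
proof (intro conjI allI impI)
  have sub: "range g \<subseteq> StructSpace" using assms range_polymap by blast
  show "zclosed (zclosure (range g))" using zclosed_zclosure[OF sub] .
  show "zclosure (range g) \<noteq> {}" using zclosure_superset[of "range g"] by blast
  fix Y1 Y2 assume Y: "zclosed Y1 \<and> zclosed Y2 \<and> zclosure (range g) \<subseteq> Y1 \<union> Y2"
  obtain P where P: "P \<subseteq> polyfun" "Y1 = {c \<in> StructSpace. \<forall>p\<in>P. p c = 0}"
    using Y by (auto simp: zclosed_def)
  obtain Q where Q: "Q \<subseteq> polyfun" "Y2 = {c \<in> StructSpace. \<forall>p\<in>Q. p c = 0}"
    using Y by (auto simp: zclosed_def)
  have "range g \<subseteq> Y1 \<or> range g \<subseteq> Y2"
  proof (rule ccontr)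
    assume "\<not> ?thesis"
    then obtain x y where "g x \<notin> Y1" "g y \<notin> Y2" by blast
    then obtain p q where pq: "p \<in> P" "p (g x) \<noteq> 0" "q \<in> Q" "q (g y) \<noteq> 0"
      using P Q sub by blast
    then obtain z where "p (g z) \<noteq> 0" "q (g z) \<noteq> 0"
      using mpf_domain[of "\<lambda>x. p (g x)" "\<lambda>x. q (g x)" x y]
        polymap_comp[OF assms] P(1) Q(1) by blast
    hence "g z \<notin> Y1 \<union> Y2" using P Q pq by blast
    thus False using Y zclosure_superset[of "range g"] by blast
  qed
  thus "zclosure (range g) \<subseteq> Y1 \<or> zclosure (range g) \<subseteq> Y2"
    using Y zclosure_least by blast
qed

text \<open>A polynomial that is nonzero somewhere on \<open>range g\<close> is, by
  \<open>mpf_domain\<close>, also nonzero at a point where \<open>h\<close> does not vanish. A union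
  of orbits therefore has to be compared with the parametrisation only off a hypersurface.\<close>

lemma zclosure_dense:
  assumes "polymap g" "h \<in> mpf" "h y \<noteq> 0" "g ` {x. h x \<noteq> 0} \<subseteq> U" "U \<subseteq> range g"
  shows "zclosure U = zclosure (range g)"
proof
  have sub: "range g \<subseteq> StructSpace" using assms(1) range_polymap by blast
  show "zclosure U \<subseteq> zclosure (range g)" using zclosure_mono[OF assms(5) sub] .
  have subO: "U \<subseteq> StructSpace" using assms(5) sub by blast
  have "p (g x) = 0" if p: "p \<in> polyfun" "\<forall>s\<in>U. p s = 0" for p x
  proof (rule ccontr)
    assume "p (g x) \<noteq> 0"
    then obtain z where "p (g z) \<noteq> 0" "h z \<noteq> 0"
      using mpf_domain[OF polymap_comp[OF assms(1) p(1)] assms(2)] assms(3) by blast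
    thus False using p(2) assms(4) by blast
  qed
  hence "range g \<subseteq> zclosure U" unfolding zclosure_eq[OF subO] using sub by auto
  thus "zclosure (range g) \<subseteq> zclosure U"
    using zclosure_least[OF zclosed_zclosure[OF subO]] by blast
qed

lemma zirreducible_Union:
  assumes "finite F" "zirreducible X" "X \<subseteq> \<Union>F" "\<And>Y. Y \<in> F \<Longrightarrow> zclosed Y"
  shows "\<exists>Y\<in>F. X \<subseteq> Y"
  using assms
proof (induction F rule: finite_induct)
  case empty
  then show ?case by (auto simp: zirreducible_def)
next
  case (insert Y F)
  show ?case
  proof (cases "F = {}")
    case True
    then show ?thesis using insert by auto
  next
    case False
    hence "zclosed (\<Union>F)" using insert by (intro zclosed_Union) auto
    hence "X \<subseteq> Y \<or> X \<subseteq> \<Union>F"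
      using insert.prems unfolding zirreducible_def by (metis Union_insert insertI1)
    thus ?thesis using insert by auto
  qed
qed

text \<open>An irreducible set covered by finitely many closed sets lies in one of them, so the
  members of \<open>F\<close> absorb every irreducible subset of \<open>V\<close>; incomparability
  makes each of them maximal.\<close>

lemma irr_components_eq:
  assumes "finite F" "\<Union>F = V" "\<And>X. X \<in> F \<Longrightarrow> zirreducible X"
    and anti: "\<And>X Y. X \<in> F \<Longrightarrow> Y \<in> F \<Longrightarrow> X \<subseteq> Y \<Longrightarrow> X = Y"
  shows "irr_components V = F"
proof (intro set_eqI iffI)
  have cl: "zclosed X" if "X \<in> F" for X using assms(3)[OF that] by (simp add: zirreducible_def)
  fix X
  {
    assume "X \<in> irr_components V"
    hence X: "zirreducible X" "X \<subseteq> V" "\<And>Y. zirreducible Y \<Longrightarrow> X \<subseteq> Y \<Longrightarrow> Y \<subseteq> V \<Longrightarrow> Y = X"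
      by (auto simp: irr_components_def)
    then obtain Y where "Y \<in> F" "X \<subseteq> Y"
      using zirreducible_Union[OF assms(1) X(1)] assms(2) cl by blast
    thus "X \<in> F" using X(3)[of Y] assms(2,3) by blast
  }
  assume X: "X \<in> F"
  have "Y = X" if Y: "zirreducible Y" "X \<subseteq> Y" "Y \<subseteq> V" for Y
  proof -
    obtain Z where "Z \<in> F" "Y \<subseteq> Z"
      using zirreducible_Union[OF assms(1) Y(1)] assms(2) cl Y by blast
    thus ?thesis using anti[OF X] Y by blast
  qed
  thus "X \<in> irr_components V" using X assms(2,3) by (auto simp: irr_components_def)
qed

section \<open>Length of chains of irreducible sets\<close>

text \<open>\<open>B\<close> indexes equations, \<open>I\<close> unknowns. Elimination: equation
  \<open>b\<close> is solved for the unknown \<open>k0\<close>, which is then substituted into the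
  remaining equations.\<close>

lemma homogeneous_system_nontrivial:
  fixes A :: "'a \<Rightarrow> 'b \<Rightarrow> 'c::field"
  assumes "finite B" "finite I" "card B < card I"
  shows "\<exists>u. (\<exists>k\<in>I. u k \<noteq> 0) \<and> (\<forall>b\<in>B. (\<Sum>k\<in>I. u k * A k b) = 0)"
  using assms
proof (induction B arbitrary: I A rule: finite_induct)
  case empty
  then obtain k where "k \<in> I" by fastforce
  thus ?case by (intro exI[of _ "\<lambda>_. 1"]) auto
next
  case (insert b B)
  show ?case
  proof (cases "\<forall>k\<in>I. A k b = 0")
    case True
    from insert.prems insert.hyps have "card B < card I" by simp
    from insert.IH[OF insert.prems(1) this, of A] obtain u
      where "\<exists>k\<in>I. u k \<noteq> 0" "\<forall>b\<in>B. (\<Sum>k\<in>I. u k * A k b) = 0" by blast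
    thus ?thesis using True by (intro exI[of _ u]) auto
  next
    case False
    then obtain k0 where k0: "k0 \<in> I" "A k0 b \<noteq> 0" by blast
    let ?I = "I - {k0}"
    define A' where "A' k b' = A k b' - A k b / A k0 b * A k0 b'" for k b'
    have "card B < card ?I" using insert.prems insert.hyps k0 by simp
    then obtain u where u: "\<exists>k\<in>?I. u k \<noteq> 0" "\<forall>b\<in>B. (\<Sum>k\<in>?I. u k * A' k b) = 0"
      using insert.IH[of ?I A'] insert.prems by blast
    define s where "s = - (\<Sum>k\<in>?I. u k * A k b) / A k0 b"
    define w where "w k = (if k = k0 then s else u k)" for k
    have sum_w: "(\<Sum>k\<in>I. w k * A k b') = s * A k0 b' + (\<Sum>k\<in>?I. u k * A k b')" for b'
      using k0(1) insert.prems(1) by (simp add: sum.remove[of I k0] w_def)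
    have "(\<Sum>k\<in>I. w k * A k b) = 0" unfolding sum_w using k0(2) by (simp add: s_def)
    moreover have "(\<Sum>k\<in>I. w k * A k b') = 0" if "b' \<in> B" for b'
    proof -
      have "(\<Sum>k\<in>?I. u k * A' k b') = (\<Sum>k\<in>?I. u k * A k b') - (\<Sum>k\<in>?I. u k * A k b) / A k0 b * A k0 b'"
        by (simp add: A'_def algebra_simps sum_subtractf sum_distrib_left sum_divide_distrib)
      thus ?thesis unfolding sum_w s_def using u(2) that by simp
    qed
    moreover have "\<exists>k\<in>I. w k \<noteq> 0" using u(1) by (auto simp: w_def)
    ultimately show ?thesis by (intro exI[of _ w]) auto
  qed
qed

definition pdeg :: "nat \<Rightarrow> (complex \<Rightarrow> complex) \<Rightarrow> bool" where
  "pdeg D f \<longleftrightarrow> (\<exists>P. degree P \<le> D \<and> (\<forall>t. f t = poly P t))"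

text \<open>The degree is bounded in each variable separately because that is what a grid with
  \<open>D + 1\<close> values per coordinate controls. Being polynomial along coordinate lines is
  all that is recorded.\<close>

definition sepdeg :: "nat \<Rightarrow> ((nat \<Rightarrow> complex) \<Rightarrow> complex) \<Rightarrow> bool" where
  "sepdeg D q \<longleftrightarrow> (\<forall>x i. pdeg D (\<lambda>t. q (x(i := t))))"

lemma sepdeg_mono: "sepdeg D q \<Longrightarrow> D \<le> E \<Longrightarrow> sepdeg E q"
  unfolding sepdeg_def pdeg_def by (meson le_trans)

lemma sepdeg_const: "sepdeg D (\<lambda>x. a)"
  unfolding sepdeg_def pdeg_def by (auto intro!: exI[of _ "[:a:]"])

lemma sepdeg_coord: "sepdeg 1 (\<lambda>x. x i)"
  unfolding sepdeg_def pdeg_def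
proof (intro allI)
  fix x :: "nat \<Rightarrow> complex" and j
  show "\<exists>P. degree P \<le> 1 \<and> (\<forall>t. (x(j := t)) i = poly P t)"
    by (cases "i = j") (auto intro: exI[of _ "[:0, 1:]"] exI[of _ "[:x i:]"])
qed

lemma sepdeg_add: "sepdeg D p \<Longrightarrow> sepdeg D q \<Longrightarrow> sepdeg D (\<lambda>x. p x + q x)"
  unfolding sepdeg_def pdeg_def by (metis degree_add_le poly_add)

lemma sepdeg_mult:
  assumes "sepdeg D p" "sepdeg E q"
  shows "sepdeg (D + E) (\<lambda>x. p x * q x)"
  unfolding sepdeg_def pdeg_def
proof (intro allI)
  fix x :: "nat \<Rightarrow> complex" and i
  obtain P Q where "degree P \<le> D" "\<And>t. p (x(i := t)) = poly P t"
      "degree Q \<le> E" "\<And>t. q (x(i := t)) = poly Q t"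
    using assms unfolding sepdeg_def pdeg_def by metis
  thus "\<exists>R. degree R \<le> D + E \<and> (\<forall>t. p (x(i := t)) * q (x(i := t)) = poly R t)"
    by (intro exI[of _ "P * Q"]) (auto intro: order_trans[OF degree_mult_le])
qed

lemma sepdeg_power: "sepdeg D p \<Longrightarrow> sepdeg (n * D) (\<lambda>x. p x ^ n)"
  by (induction n) (auto intro: sepdeg_const sepdeg_mult)

lemma sepdeg_sum: "(\<And>i. i \<in> I \<Longrightarrow> sepdeg D (p i)) \<Longrightarrow> sepdeg D (\<lambda>x. \<Sum>i\<in>I. p i x)"
  by (induction I rule: infinite_finite_induct) (auto intro: sepdeg_const sepdeg_add)

lemma mpf_sepdeg: "q \<in> mpf \<Longrightarrow> \<exists>D. sepdeg D q"
proof (induction rule: mpf.induct)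
  case (mpf_add p q)
  then obtain D E where "sepdeg D p" "sepdeg E q" by blast
  hence "sepdeg (max D E) (\<lambda>x. p x + q x)"
    by (intro sepdeg_add) (auto intro: sepdeg_mono)
  thus ?case by blast
qed (use sepdeg_const sepdeg_coord sepdeg_mult in blast)+

lemma sepdeg_zero:
  assumes "sepdeg M q" "\<And>a. a \<le> M \<Longrightarrow> q (x(i := of_nat a)) = 0"
  shows "q (x(i := t)) = 0"
proof -
  obtain P where P: "degree P \<le> M" "\<And>t. q (x(i := t)) = poly P t"
    using assms(1) unfolding sepdeg_def pdeg_def by metis
  have "P = 0"
  proof (rule ccontr)
    assume "P \<noteq> 0"
    have "card ((of_nat :: nat \<Rightarrow> complex) ` {..M}) \<le> card {t. poly P t = 0}"
      using assms(2) P(2) poly_roots_finite[OF \<open>P \<noteq> 0\<close>] by (intro card_mono) auto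
    also have "\<dots> \<le> M" using card_poly_roots_bound[OF \<open>P \<noteq> 0\<close>] P(1) by simp
    finally show False by (simp add: card_image inj_of_nat)
  qed
  thus ?thesis using P by simp
qed

definition gridpt :: "complex \<Rightarrow> complex \<Rightarrow> complex \<Rightarrow> complex \<Rightarrow> nat \<Rightarrow> complex" where
  "gridpt a b c d = (\<lambda>_. 1)(0 := a, 1 := b, 2 := c, 3 := d)"

text \<open>The coordinates are released from the grid one at a time, from index 3 down to index 0,
  each by \<open>sepdeg_zero\<close>.\<close>

lemma sepdeg_grid_zero:
  assumes q: "sepdeg M q"
    and z: "\<And>a b c d. a \<le> M \<Longrightarrow> b \<le> M \<Longrightarrow> c \<le> M \<Longrightarrow> d \<le> M \<Longrightarrow>
      q (gridpt (of_nat a) (of_nat b) (of_nat c) (of_nat d)) = 0"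
    and x: "\<forall>i\<ge>4. x i = 1"
  shows "q x = 0"
proof -
  have 1: "q (gridpt (of_nat a) (of_nat b) (of_nat c) t) = 0"
    if "a \<le> M" "b \<le> M" "c \<le> M" for a b c t
    using sepdeg_zero[OF q, of "gridpt (of_nat a) (of_nat b) (of_nat c) 0" 3 t] z[OF that]
    by (simp add: gridpt_def)
  have 2: "q (gridpt (of_nat a) (of_nat b) s t) = 0"
    if "a \<le> M" "b \<le> M" for a b s t
    using sepdeg_zero[OF q, of "gridpt (of_nat a) (of_nat b) 0 t" 2 s] 1[OF that]
    by (simp add: gridpt_def fun_upd_twist)
  have 3: "q (gridpt (of_nat a) r s t) = 0" if "a \<le> M" for a r s t
    using sepdeg_zero[OF q, of "gridpt (of_nat a) 0 s t" 1 r] 2[OF that]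
    by (simp add: gridpt_def fun_upd_twist)
  have 4: "q (gridpt p r s t) = 0" for p r s t
    using sepdeg_zero[OF q, of "gridpt 0 r s t" 0 p] 3
    by (simp add: gridpt_def fun_upd_twist)
  have "x = gridpt (x 0) (x 1) (x 2) (x 3)"
  proof
    fix i :: nat
    consider "i = 0" | "i = 1" | "i = 2" | "i = 3" | "i \<ge> 4" by linarith
    thus "x i = gridpt (x 0) (x 1) (x 2) (x 3) i"
      using x by cases (auto simp: gridpt_def)
  qed
  thus ?thesis using 4 by metis
qed

definition indep :: "nat \<Rightarrow> (nat \<Rightarrow> sstruct \<Rightarrow> complex) \<Rightarrow> sstruct set \<Rightarrow> bool" where
  "indep m \<phi> Z \<longleftrightarrow> (\<forall>u. (\<forall>c\<in>Z. (\<Sum>k<m. u k * \<phi> k c) = 0) \<longrightarrow> (\<forall>k<m. u k = 0))"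

lemma sum_lessThan_shift: "(\<Sum>k<m + n. f k) = (\<Sum>k<m. f k) + (\<Sum>k<n. f (m + k))"
  for f :: "nat \<Rightarrow> 'a::comm_monoid_add"
  by (induction n) (auto simp: add.assoc)

lemma zirreducible_mult_zero:
  assumes "zirreducible Z" "p \<in> polyfun" "q \<in> polyfun"
    "\<And>c. c \<in> Z \<Longrightarrow> p c * q c = 0" "c0 \<in> Z" "p c0 \<noteq> 0" "c \<in> Z"
  shows "q c = 0"
proof -
  have cl: "zclosed Z" using assms(1) by (simp add: zirreducible_def)
  have "Z \<subseteq> {c \<in> Z. p c = 0} \<union> {c \<in> Z. q c = 0}" using assms(4) by auto
  thus ?thesis
    using assms zclosed_hypersurface[OF cl] unfolding zirreducible_def by blast
qed

text \<open>The index \<open>k\<close> encodes \<open>\<phi> (k mod m)\<close> times the power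
  \<open>k div m\<close> of \<open>g\<close>. On \<open>Z\<close> only the power 0 survives, so its
  coefficients vanish by independence there. What is left is \<open>g\<close> times a shorter
  relation, and \<open>g\<close> can be cancelled on the irreducible set \<open>Z'\<close>.\<close>

lemma indep_extend:
  assumes irr: "zirreducible Z'" and "Z \<subseteq> Z'" and g: "g \<in> polyfun" "\<And>c. c \<in> Z \<Longrightarrow> g c = 0"
    and c0: "c0 \<in> Z'" "g c0 \<noteq> 0" and \<phi>: "\<And>k. \<phi> k \<in> polyfun" "indep m \<phi> Z" and "m > 0"
  shows "indep (n * m) (\<lambda>k c. \<phi> (k mod m) c * g c ^ (k div m)) Z'"
proof (induction n)
  case 0
  then show ?case by (simp add: indep_def)
next
  case (Suc n)
  let ?\<psi> = "\<lambda>k c. \<phi> (k mod m) c * g c ^ (k div m)"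
  show ?case unfolding indep_def
  proof (intro allI impI)
    fix u k
    assume z: "\<forall>c\<in>Z'. (\<Sum>k<Suc n * m. u k * ?\<psi> k c) = 0" and k: "k < Suc n * m"
    let ?r = "\<lambda>c. \<Sum>k<n * m. u (m + k) * ?\<psi> k c"
    have split: "(\<Sum>k<Suc n * m. u k * ?\<psi> k c) = (\<Sum>k<m. u k * \<phi> k c) + g c * ?r c" for c
      using \<open>m > 0\<close> by (simp add: sum_lessThan_shift sum_distrib_left algebra_simps)
    have "(\<Sum>k<m. u k * \<phi> k c) = 0" if "c \<in> Z" for c
    proof -
      have "(\<Sum>k<Suc n * m. u k * ?\<psi> k c) = 0" using z that \<open>Z \<subseteq> Z'\<close> by blast
      thus ?thesis unfolding split using g(2)[OF that] by simp
    qed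
    hence low: "\<forall>k<m. u k = 0" using \<phi>(2) by (auto simp: indep_def)
    hence gr: "g c * ?r c = 0" if "c \<in> Z'" for c
    proof -
      have "(\<Sum>k<Suc n * m. u k * ?\<psi> k c) = 0" using z that by blast
      thus ?thesis unfolding split using low by simp
    qed
    have "?r \<in> polyfun" using g(1) \<phi>(1) by (intro pf_intros)
    hence "?r c = 0" if "c \<in> Z'" for c
      using zirreducible_mult_zero[OF irr g(1) _ gr c0(1,2) that] by blast
    moreover have "(\<forall>c\<in>Z'. ?r c = 0) \<longrightarrow> (\<forall>k<n * m. u (m + k) = 0)"
      using Suc.IH unfolding indep_def by (rule spec)
    ultimately have "\<forall>k<n * m. u (m + k) = 0" by blast
    thus "u k = 0" using low k
      by (metis add_diff_inverse_nat less_diff_conv2 linorder_not_less mult_Suc add.commute nat_add_left_cancel_less)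
  qed
qed

lemma indep_chain:
  assumes irr: "\<And>i. i \<le> n \<Longrightarrow> zirreducible (Z i)"
    and sub: "\<And>i. i < n \<Longrightarrow> Z i \<subseteq> Z (Suc i)"
    and g: "\<And>i. i < n \<Longrightarrow> g i \<in> polyfun"
    and zero: "\<And>i c. i < n \<Longrightarrow> c \<in> Z i \<Longrightarrow> g i c = 0"
    and nz: "\<And>i. i < n \<Longrightarrow> \<exists>c\<in>Z (Suc i). g i c \<noteq> 0"
    and deg: "\<And>i. i < n \<Longrightarrow> sepdeg D (\<lambda>x. g i (\<gamma> x))"
  shows "\<exists>\<phi>. (\<forall>k. \<phi> k \<in> polyfun) \<and> (\<forall>k<(N + 1) ^ n. sepdeg (n * N * D) (\<lambda>x. \<phi> k (\<gamma> x)))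
    \<and> indep ((N + 1) ^ n) \<phi> (Z n)"
  using assms
proof (induction n)
  case 0
  then obtain c where "c \<in> Z 0" by (auto simp: zirreducible_def)
  thus ?case
    by (intro exI[of _ "\<lambda>_ _. 1"]) (auto simp: indep_def intro: pf_const sepdeg_const)
next
  case (Suc n)
  let ?m = "(N + 1) ^ n"
  have "\<exists>\<phi>. (\<forall>k. \<phi> k \<in> polyfun) \<and> (\<forall>k<?m. sepdeg (n * N * D) (\<lambda>x. \<phi> k (\<gamma> x))) \<and> indep ?m \<phi> (Z n)"
    by (rule Suc.IH) (use Suc.prems in auto)
  then obtain \<phi> where \<phi>: "\<And>k. \<phi> k \<in> polyfun" "\<And>k. k < ?m \<Longrightarrow> sepdeg (n * N * D) (\<lambda>x. \<phi> k (\<gamma> x))"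
    "indep ?m \<phi> (Z n)" by blast
  let ?\<psi> = "\<lambda>k c. \<phi> (k mod ?m) c * g n c ^ (k div ?m)"
  obtain c0 where c0: "c0 \<in> Z (Suc n)" "g n c0 \<noteq> 0" using Suc.prems(5)[of n] by auto
  have "indep ((N + 1) * ?m) ?\<psi> (Z (Suc n))"
    
  proof (rule indep_extend[where Z = "Z n" and g = "g n" and \<phi> = \<phi>])
    show "zirreducible (Z (Suc n))" "Z n \<subseteq> Z (Suc n)" "g n \<in> polyfun"
      "\<And>c. c \<in> Z n \<Longrightarrow> g n c = 0" using Suc.prems by auto
  qed (use c0 \<phi> in auto)
  moreover have "?\<psi> k \<in> polyfun" for k
    using \<phi>(1) Suc.prems(3)[of n] by (auto intro: pf_intros)
  moreover have "sepdeg (Suc n * N * D) (\<lambda>x. ?\<psi> k (\<gamma> x))" if "k < (N + 1) * ?m" for k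
  proof -
    have "k div ?m < N + 1" using that by (simp add: less_mult_imp_div_less)
    hence "(k div ?m) * D \<le> N * D" by simp
    moreover have "sepdeg (n * N * D + (k div ?m) * D) (\<lambda>x. ?\<psi> k (\<gamma> x))"
      using \<phi>(2)[of "k mod ?m"] Suc.prems(6)[of n] by (intro sepdeg_mult sepdeg_power) auto
    ultimately show ?thesis by (elim sepdeg_mono) (simp add: algebra_simps)
  qed
  ultimately show ?case by (intro exI[of _ ?\<psi>]) auto
qed

text \<open>Monomials of degree at most \<open>N\<close> in each of five functions separating the chain are
  independent, but they are determined by their values on a grid with fewer points.\<close>

lemma no_chain_of_length_5:
  assumes irr: "\<And>i. i \<le> 5 \<Longrightarrow> zirreducible (Z i)"
    and strict: "\<And>i. i < 5 \<Longrightarrow> Z i \<subset> Z (Suc i)"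
    and \<gamma>: "polymap \<gamma>" and Z5: "Z 5 \<subseteq> zclosure (\<gamma> ` {x. \<forall>i\<ge>4. x i = 1})"
  shows False
proof -
  let ?A = "{x :: nat \<Rightarrow> complex. \<forall>i\<ge>4. x i = 1}"
  have "\<exists>g. g \<in> polyfun \<and> (\<forall>c\<in>Z i. g c = 0) \<and> (\<exists>c\<in>Z (Suc i). g c \<noteq> 0)" if i: "i < 5" for i
  proof -
    have cl: "zclosed (Z i)" "zclosed (Z (Suc i))"
      using irr[of i] irr[of "Suc i"] i by (auto simp: zirreducible_def)
    obtain P where P: "P \<subseteq> polyfun" "Z i = {c \<in> StructSpace. \<forall>p\<in>P. p c = 0}"
      using cl by (auto simp: zclosed_def)
    obtain c where c: "c \<in> Z (Suc i)" "c \<notin> Z i" using strict[OF i] by blast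
    then obtain p where "p \<in> P" "p c \<noteq> 0" using P zclosed_subset[OF cl(2)] by blast
    thus ?thesis using P c by blast
  qed
  then obtain g where g: "\<And>i. i < 5 \<Longrightarrow> g i \<in> polyfun" "\<And>i c. i < 5 \<Longrightarrow> c \<in> Z i \<Longrightarrow> g i c = 0"
    "\<And>i. i < 5 \<Longrightarrow> \<exists>c\<in>Z (Suc i). g i c \<noteq> 0" by metis
  have "\<exists>D. sepdeg D (\<lambda>x. g i (\<gamma> x))" if "i < 5" for i
    using mpf_sepdeg[OF polymap_comp[OF \<gamma> g(1)[OF that]]] .
  then obtain d where d: "\<And>i. i < 5 \<Longrightarrow> sepdeg (d i) (\<lambda>x. g i (\<gamma> x))" by metis
  define D where "D = Max (d ` {..<5})"
  have D: "sepdeg D (\<lambda>x. g i (\<gamma> x))" if "i < 5" for i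
    using d[OF that] by (rule sepdeg_mono) (use that in \<open>auto simp: D_def\<close>)
  \<comment> \<open>The grid has at most \<open>((5 * D + 1) * (N + 1)) ^ 4\<close> points; this
    choice of \<open>N\<close> turns the bound into \<open>N * (N + 1) ^ 4\<close>, just below the
    number \<open>(N + 1) ^ 5\<close> of monomials.\<close>
  define N where "N = (5 * D + 1) ^ 4"
  define M where "M = 5 * N * D"
  obtain \<phi> where \<phi>: "\<And>k. \<phi> k \<in> polyfun" "\<And>k. k < (N + 1) ^ 5 \<Longrightarrow> sepdeg M (\<lambda>x. \<phi> k (\<gamma> x))"
    "indep ((N + 1) ^ 5) \<phi> (Z 5)"
    using indep_chain[of 5 Z g D \<gamma> N, OF irr _ g D] strict unfolding M_def by blast
  define K where "K = (N + 1) ^ 5"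
  let ?B = "{..M} \<times> {..M} \<times> {..M} \<times> {..M}"
  let ?pt = "\<lambda>(a, b, c, d). gridpt (of_nat a) (of_nat b) (of_nat c) (of_nat d)"
  have "M + 1 \<le> (5 * D + 1) * (N + 1)" by (simp add: M_def algebra_simps)
  hence "(M + 1) ^ 4 \<le> ((5 * D + 1) * (N + 1)) ^ 4" by (rule power_mono) simp
  also have "\<dots> = N * (N + 1) ^ 4" by (simp only: N_def power_mult_distrib)
  also have "\<dots> < (N + 1) ^ 5" by (simp add: eval_nat_numeral)
  finally have "(M + 1) ^ 4 < K" unfolding K_def .
  hence "card ?B < card {..<K}" by (simp add: card_cartesian_product eval_nat_numeral)
  hence "\<exists>u. (\<exists>k\<in>{..<K}. u k \<noteq> 0) \<and> (\<forall>b\<in>?B. (\<Sum>k<K. u k * \<phi> k (\<gamma> (?pt b))) = 0)"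
    by (intro homogeneous_system_nontrivial) auto
  then obtain u where u: "\<exists>k\<in>{..<K}. u k \<noteq> 0"
    "\<forall>b\<in>?B. (\<Sum>k<K. u k * \<phi> k (\<gamma> (?pt b))) = 0" by (elim exE conjE)
  let ?r = "\<lambda>c. \<Sum>k<K. u k * \<phi> k c"
  have "sepdeg M (\<lambda>x. ?r (\<gamma> x))"
    using \<phi>(2) unfolding K_def by (intro sepdeg_sum sepdeg_mult[of 0 _ M, simplified]) (auto intro: sepdeg_const)
  hence "?r (\<gamma> x) = 0" if "x \<in> ?A" for x
    using sepdeg_grid_zero[of M "\<lambda>x. ?r (\<gamma> x)" x] u(2) that by fastforce
  moreover have "?r \<in> polyfun" using \<phi>(1) by (intro pf_intros)
  ultimately have "?r c = 0" if "c \<in> Z 5" for c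
    using zclosure_vanish[of ?r "\<gamma> ` ?A" c] that Z5 range_polymap[OF \<gamma>] by blast
  thus False using \<phi>(3) u(1) unfolding K_def indep_def by (meson lessThan_iff)
qed

section \<open>The group action\<close>

declare One_nat_def [simp del] \<comment> \<open>keeps the basis index \<open>1\<close> from turning into \<open>Suc 0\<close>\<close>

lemma all_less_3: "(\<forall>i<3::nat. P i) \<longleftrightarrow> P 0 \<and> P 1 \<and> P 2"
  by (auto simp: numeral_3_eq_3 numeral_2_eq_2 less_Suc_eq One_nat_def)

lemma sum_less_3: "(\<Sum>i<3::nat. f i) = f 0 + f 1 + f 2"
  by (simp add: numeral_3_eq_3 numeral_2_eq_2 One_nat_def)

lemma nat_cases_3:
  obtains "i = 0" | "i = 1" | "i = 2" | "(i::nat) \<ge> 3"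
  by linarith

definition mm :: "(nat \<Rightarrow> nat \<Rightarrow> complex) \<Rightarrow> (nat \<Rightarrow> nat \<Rightarrow> complex) \<Rightarrow> nat \<Rightarrow> nat \<Rightarrow> complex" where
  "mm A B i j = (\<Sum>k<3. A i k * B k j)"

lemma mm_assoc: "mm (mm A B) C = mm A (mm B C)"
  by (intro ext) (simp add: mm_def sum_less_3 algebra_simps)

lemma mm_one_left:
  assumes "\<And>i j. i < 3 \<Longrightarrow> j < 3 \<Longrightarrow> E i j = (if i = j then 1 else 0)" "i < 3"
  shows "mm E D i j = D i j"
proof -
  have "mm E D i j = (\<Sum>k<3. if i = k then D k j else 0)"
    unfolding mm_def by (intro sum.cong) (auto simp: assms)
  thus ?thesis using assms(2) by simp
qed

lemma gl_pair_swap: "gl_pair G H \<Longrightarrow> gl_pair H G"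
  unfolding gl_pair_def by blast

lemma gl_pair_mm:
  assumes "gl_pair G H" "gl_pair G' H'"
  shows "gl_pair (mm G' G) (mm H H')"
proof -
  let ?d = "\<lambda>i j. if i = j then 1 else 0 :: complex"
  have 1: "mm G H i j = ?d i j" "mm H G i j = ?d i j" "mm G' H' i j = ?d i j" "mm H' G' i j = ?d i j"
    if "i < 3" "j < 3" for i j
    using assms that by (auto simp: gl_pair_def mm_def)
  have cancel: "mm A (mm (mm B C) D) i j = mm A D i j"
    if "\<And>i j. i < 3 \<Longrightarrow> j < 3 \<Longrightarrow> mm B C i j = ?d i j" for A B C D i j
    unfolding mm_def[of A] using mm_one_left[where E = "mm B C" and D = D, OF that] by (intro sum.cong) auto
  have "mm (mm G' G) (mm H H') i j = ?d i j" "mm (mm H H') (mm G' G) i j = ?d i j"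
    if "i < 3" "j < 3" for i j
    using cancel[of G H G' H' i j] cancel[of H' G' H G i j] 1 that by (simp_all add: mm_assoc)
  moreover have "mm G' G i j = 0" "mm H H' i j = 0" if "i < 3" "j < 3" "par i \<noteq> par j" for i j
  proof -
    have "\<forall>k<3. par i \<noteq> par k \<or> par k \<noteq> par j" using that by auto
    hence "\<forall>k<3. G' i k * G k j = 0" "\<forall>k<3. H i k * H' k j = 0"
      using assms that unfolding gl_pair_def by (metis mult_zero_left mult_zero_right)+
    thus "mm G' G i j = 0" "mm H H' i j = 0"
      unfolding mm_def by (intro sum.neutral; blast)+
  qed
  ultimately show ?thesis unfolding gl_pair_def mm_def[symmetric] by blast
qed

lemma sum_product_3:
  fixes x y z :: "nat \<Rightarrow> complex"
  shows "(\<Sum>p\<in>A. \<Sum>q\<in>A. \<Sum>r\<in>A. x p * y q * c * z r) = (\<Sum>p\<in>A. x p) * (\<Sum>q\<in>A. y q) * c * (\<Sum>r\<in>A. z r)"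
  by (simp add: sum_distrib_left[symmetric] sum_distrib_right[symmetric])

lemma sum_swap_3:
  fixes f :: "nat \<Rightarrow> nat \<Rightarrow> nat \<Rightarrow> nat \<Rightarrow> nat \<Rightarrow> nat \<Rightarrow> complex"
  shows "(\<Sum>p\<in>A. \<Sum>q\<in>A. \<Sum>r\<in>A. \<Sum>a\<in>A. \<Sum>b\<in>A. \<Sum>l\<in>A. f p q r a b l) =
    (\<Sum>a\<in>A. \<Sum>b\<in>A. \<Sum>l\<in>A. \<Sum>p\<in>A. \<Sum>q\<in>A. \<Sum>r\<in>A. f p q r a b l)" (is "?L = ?R")
proof -
  have "?L = (\<Sum>(p, q, r)\<in>A \<times> A \<times> A. \<Sum>(a, b, l)\<in>A \<times> A \<times> A. f p q r a b l)"
    by (simp add: sum.cartesian_product[symmetric])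
  also have "\<dots> = (\<Sum>(a, b, l)\<in>A \<times> A \<times> A. \<Sum>(p, q, r)\<in>A \<times> A \<times> A. f p q r a b l)"
    unfolding case_prod_unfold by (rule sum.swap)
  also have "\<dots> = ?R" by (simp add: sum.cartesian_product[symmetric])
  finally show ?thesis .
qed

lemma act_act: "act G' H' (act G H c) = act (mm G' G) (mm H H') c"
proof (intro ext)
  fix i j k
  let ?A = "{..<3::nat}"
  show "act G' H' (act G H c) i j k = act (mm G' G) (mm H H') c i j k"
  proof (cases "i < 3 \<and> j < 3 \<and> k < 3")
    case True
    have "act G' H' (act G H c) i j k =
      (\<Sum>p\<in>?A. \<Sum>q\<in>?A. \<Sum>r\<in>?A. \<Sum>a\<in>?A. \<Sum>b\<in>?A. \<Sum>l\<in>?A.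
        (H a p * H' p i) * (H b q * H' q j) * c a b l * (G' k r * G r l))"
      using True by (simp add: act_def sum_distrib_left sum_distrib_right mult_ac)
    also have "\<dots> = act (mm G' G) (mm H H') c i j k"
      unfolding sum_swap_3 sum_product_3 using True by (simp add: act_def mm_def)
    finally show ?thesis .
  qed (auto simp: act_def)
qed

lemma act_one:
  assumes "c \<in> StructSpace" "\<And>i j. i < 3 \<Longrightarrow> j < 3 \<Longrightarrow> G i j = (if i = j then 1 else 0)"
    "\<And>i j. i < 3 \<Longrightarrow> j < 3 \<Longrightarrow> H i j = (if i = j then 1 else 0)"
  shows "act G H c = c"
proof (intro ext)
  fix i j k
  show "act G H c i j k = c i j k"
  proof (cases "i < 3 \<and> j < 3 \<and> k < 3")
    case True
    have e: "G k l = (if k = l then 1 else 0)" if "l < 3" for l using assms(2) True that by blast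
    have f: "H a i = (if a = i then 1 else 0)" "H a j = (if a = j then 1 else 0)" if "a < 3" for a
      using assms(3) True that by blast+
    have "act G H c i j k = (\<Sum>a<3. \<Sum>b<3. \<Sum>l<3. H a i * H b j * c a b l * G k l)"
      using True by (simp add: act_def)
    also have "\<dots> = (\<Sum>a<3. \<Sum>b<3. \<Sum>l<3. if l = k then if b = j then if a = i then c a b l else 0 else 0 else 0)"
      by (intro sum.cong refl) (auto simp: e f)
    also have "\<dots> = c i j k" using True by simp
    finally show ?thesis .
  next
    case False
    thus ?thesis using assms(1) by (auto simp: act_def StructSpace_def)
  qed
qed

lemma orbit_refl:
  assumes "c \<in> StructSpace"
  shows "c \<in> orbit c"
proof -
  let ?d = "\<lambda>i j. if i = j then 1 else 0 :: complex"
  have "gl_pair ?d ?d" by (auto simp: gl_pair_def all_less_3 sum_less_3)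
  moreover have "c = act ?d ?d c" using act_one[OF assms, of ?d ?d] by simp
  ultimately show ?thesis unfolding orbit_def by blast
qed

lemma orbit_trans: "c' \<in> orbit c \<Longrightarrow> orbit c' \<subseteq> orbit c"
  using gl_pair_mm act_act unfolding orbit_def by fastforce

lemma orbit_sym:
  assumes "c \<in> StructSpace" "c' \<in> orbit c"
  shows "c \<in> orbit c'"
proof -
  obtain G H where GH: "gl_pair G H" "c' = act G H c" using assms(2) by (auto simp: orbit_def)
  have "act H G c' = c" unfolding GH(2) act_act
    using GH(1) by (intro act_one assms(1)) (auto simp: gl_pair_def mm_def)
  thus ?thesis using gl_pair_swap[OF GH(1)] by (auto simp: orbit_def)
qed

lemma orbit_eq: "c \<in> StructSpace \<Longrightarrow> c' \<in> orbit c \<Longrightarrow> orbit c' = orbit c"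
  using orbit_trans orbit_sym by blast

lemma gl_pair_eqs:
  assumes "gl_pair G H"
  shows "G 0 0 * H 0 0 = 1" "H 0 0 * G 0 0 = 1"
    "G 0 1 = 0" "G 0 2 = 0" "G 1 0 = 0" "G 2 0 = 0" "H 0 1 = 0" "H 0 2 = 0" "H 1 0 = 0" "H 2 0 = 0"
    "G 1 1 * H 1 1 + G 1 2 * H 2 1 = 1" "G 1 1 * H 1 2 + G 1 2 * H 2 2 = 0"
    "G 2 1 * H 1 1 + G 2 2 * H 2 1 = 0" "G 2 1 * H 1 2 + G 2 2 * H 2 2 = 1"
    "H 1 1 * G 1 1 + H 1 2 * G 2 1 = 1" "H 1 1 * G 1 2 + H 1 2 * G 2 2 = 0"
    "H 2 1 * G 1 1 + H 2 2 * G 2 1 = 0" "H 2 1 * G 1 2 + H 2 2 * G 2 2 = 1"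
proof -
  show z: "G 0 1 = 0" "G 0 2 = 0" "G 1 0 = 0" "G 2 0 = 0" "H 0 1 = 0" "H 0 2 = 0" "H 1 0 = 0" "H 2 0 = 0"
    using assms unfolding gl_pair_def by (simp_all add: all_less_3 par_def)
  show "G 0 0 * H 0 0 = 1" "H 0 0 * G 0 0 = 1"
    "G 1 1 * H 1 1 + G 1 2 * H 2 1 = 1" "G 1 1 * H 1 2 + G 1 2 * H 2 2 = 0"
    "G 2 1 * H 1 1 + G 2 2 * H 2 1 = 0" "G 2 1 * H 1 2 + G 2 2 * H 2 2 = 1"
    "H 1 1 * G 1 1 + H 1 2 * G 2 1 = 1" "H 1 1 * G 1 2 + H 1 2 * G 2 2 = 0"
    "H 2 1 * G 1 1 + H 2 2 * G 2 1 = 0" "H 2 1 * G 1 2 + H 2 2 * G 2 2 = 1"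
    using assms unfolding gl_pair_def by (simp_all add: all_less_3 sum_less_3 z)
qed

section \<open>Structures of type (1,2)\<close>

text \<open>The rows \<open>L j\<close> and \<open>M i\<close> are the coordinates of
  \<open>e f_j\<close> and \<open>f_i e\<close>. Entries outside the indices 1 and 2 are ignored,
  which is why \<open>mk_eqI\<close> compares only those.\<close>

definition mk :: "complex \<Rightarrow> (nat \<Rightarrow> nat \<Rightarrow> complex) \<Rightarrow> (nat \<Rightarrow> nat \<Rightarrow> complex) \<Rightarrow>
    (nat \<Rightarrow> nat \<Rightarrow> complex) \<Rightarrow> sstruct" where
  "mk a L M B i j k =
    (if i = 0 \<and> j = 0 \<and> k = 0 then a
     else if i = 0 \<and> j \<in> {1,2} \<and> k \<in> {1,2} then L j k
     else if j = 0 \<and> i \<in> {1,2} \<and> k \<in> {1,2} then M i k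
     else if k = 0 \<and> i \<in> {1,2} \<and> j \<in> {1,2} then B i j else 0)"

lemma mk_StructSpace: "mk a L M B \<in> StructSpace"
  by (auto simp: StructSpace_def mk_def par_def)

lemma mk_simps:
  "mk a L M B 0 0 0 = a"
  "mk a L M B 0 1 1 = L 1 1" "mk a L M B 0 1 2 = L 1 2" "mk a L M B 0 2 1 = L 2 1" "mk a L M B 0 2 2 = L 2 2"
  "mk a L M B 1 0 1 = M 1 1" "mk a L M B 1 0 2 = M 1 2" "mk a L M B 2 0 1 = M 2 1" "mk a L M B 2 0 2 = M 2 2"
  "mk a L M B 1 1 0 = B 1 1" "mk a L M B 1 2 0 = B 1 2" "mk a L M B 2 1 0 = B 2 1" "mk a L M B 2 2 0 = B 2 2"
  by (simp_all add: mk_def)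

lemma mk_eqI:
  assumes "a = a'" "\<And>i j. i \<in> {1,2} \<Longrightarrow> j \<in> {1,2} \<Longrightarrow> L i j = L' i j"
    "\<And>i j. i \<in> {1,2} \<Longrightarrow> j \<in> {1,2} \<Longrightarrow> M i j = M' i j" "\<And>i j. i \<in> {1,2} \<Longrightarrow> j \<in> {1,2} \<Longrightarrow> B i j = B' i j"
  shows "mk a L M B = mk a' L' M' B'"
  by (intro ext) (simp add: mk_def assms)

lemma StructSpace_mk:
  assumes "c \<in> StructSpace"
  shows "c = mk (c 0 0 0) (c 0) (\<lambda>i k. c i 0 k) (\<lambda>i j. c i j 0)"
proof (intro ext)
  fix i j k
  have z: "c i j k = 0" if "\<not> (i < 3 \<and> j < 3 \<and> k < 3 \<and> par k = (par i + par j) mod 2)"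
    using assms that by (auto simp: StructSpace_def)
  show "c i j k = mk (c 0 0 0) (c 0) (\<lambda>i k. c i 0 k) (\<lambda>i j. c i j 0) i j k"
    by (cases rule: nat_cases_3[of i]; cases rule: nat_cases_3[of j]; cases rule: nat_cases_3[of k])
      (use z in \<open>auto simp: mk_def par_def\<close>)
qed

lemma act_mk:
  assumes "gl_pair G H"
  shows "act G H (mk a L M B) = mk (H 0 0 * a)
    (\<lambda>j k. H 0 0 * (\<Sum>b\<in>{1,2}. \<Sum>l\<in>{1,2}. H b j * L b l * G k l))
    (\<lambda>j k. H 0 0 * (\<Sum>b\<in>{1,2}. \<Sum>l\<in>{1,2}. H b j * M b l * G k l))
    (\<lambda>i j. G 0 0 * (\<Sum>a\<in>{1,2}. \<Sum>b\<in>{1,2}. H a i * H b j * B a b))"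
proof (intro ext)
  note e = gl_pair_eqs(1-10)[OF assms]
  have a: "H 0 0 * H 0 0 * a * G 0 0 = H 0 0 * a" using e(1) by (simp add: mult_ac)
  fix i j k
  show "act G H (mk a L M B) i j k = mk (H 0 0 * a)
    (\<lambda>j k. H 0 0 * (\<Sum>b\<in>{1,2}. \<Sum>l\<in>{1,2}. H b j * L b l * G k l))
    (\<lambda>j k. H 0 0 * (\<Sum>b\<in>{1,2}. \<Sum>l\<in>{1,2}. H b j * M b l * G k l))
    (\<lambda>i j. G 0 0 * (\<Sum>a\<in>{1,2}. \<Sum>b\<in>{1,2}. H a i * H b j * B a b)) i j k"
    by (cases rule: nat_cases_3[of i]; cases rule: nat_cases_3[of j]; cases rule: nat_cases_3[of k])
      (simp_all add: act_def sum_less_3 mk_def e(1,3-10) a algebra_simps)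
qed

lemma smul_mk:
  "smul (mk a L M B) x y = (\<lambda>k. if k = 0 then a * x 0 * y 0 + (\<Sum>i\<in>{1,2}. \<Sum>j\<in>{1,2}. x i * y j * B i j)
    else if k \<in> {1,2} then x 0 * (\<Sum>j\<in>{1,2}. y j * L j k) + y 0 * (\<Sum>i\<in>{1,2}. x i * M i k) else 0)"
  by (rule ext) (simp add: smul_def sum_less_3 mk_def algebra_simps)

lemma homog_0: "homog 0 x \<Longrightarrow> i \<noteq> 0 \<Longrightarrow> x i = 0"
  by (auto simp: homog_def par_def split: if_splits)

lemma homog_1: "homog 1 x \<Longrightarrow> x 0 = 0"
  by (auto simp: homog_def par_def split: if_splits)

section \<open>The irreducible families\<close>

text \<open>\<open>cone\<close> is the orbit of the structure with \<open>e e = e\<close>, \<open>e f\<^sub>i = \<alpha>\<^sub>i f\<^sub>i\<close>, \<open>f\<^sub>i e = \<beta>\<^sub>i f\<^sub>i\<close>, together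
  with its limits: \<open>s = \<phi>(v)\<close>, \<open>R = v \<otimes> \<phi>\<close> and \<open>s - R\<close> are \<open>s\<close> times two complementary projections.\<close>

definition cone_s :: "(nat \<Rightarrow> complex) \<Rightarrow> complex" where
  "cone_s x = x 0 * x 2 + x 1 * x 3"

definition cone_mat :: "complex \<Rightarrow> complex \<Rightarrow> (nat \<Rightarrow> complex) \<Rightarrow> nat \<Rightarrow> nat \<Rightarrow> complex" where
  "cone_mat a b x j k = (a - b) * ((if j = 1 then x 2 else x 3) * (if k = 1 then x 0 else x 1))
    + b * (if j = k then cone_s x else 0)"

definition cone :: "complex \<Rightarrow> complex \<Rightarrow> complex \<Rightarrow> complex \<Rightarrow> (nat \<Rightarrow> complex) \<Rightarrow> sstruct" where
  "cone a1 a2 b1 b2 x = mk (cone_s x) (cone_mat a1 a2 x) (cone_mat b1 b2 x) (\<lambda>_ _. 0)"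

definition unital :: "complex \<Rightarrow> complex \<Rightarrow> complex \<Rightarrow> complex \<Rightarrow> sstruct" where
  "unital a1 a2 b1 b2 = mk 1 (\<lambda>j k. if j = k then if j = 1 then a1 else a2 else 0)
    (\<lambda>j k. if j = k then if j = 1 then b1 else b2 else 0) (\<lambda>_ _. 0)"

text \<open>Cutting off after \<open>n\<close> entries gives the chain of linear subspaces for the lower bound on the dimension.\<close>

definition form_idx :: "nat \<Rightarrow> nat \<Rightarrow> nat" where
  "form_idx i j = (if i = 1 then if j = 1 then 0 else 1 else if j = 1 then 2 else 3)"

definition forms :: "nat \<Rightarrow> (nat \<Rightarrow> complex) \<Rightarrow> sstruct" where
  "forms n x = mk 0 (\<lambda>_ _. 0) (\<lambda>_ _. 0) (\<lambda>i j. if form_idx i j < n then x (form_idx i j) else 0)"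

text \<open>\<open>e f = \<lambda> \<phi>(f) J\<phi>\<close>, \<open>f e = \<mu> \<phi>(f) J\<phi>\<close>, \<open>f g = b \<phi>(f) \<phi>(g) e\<close> with \<open>J(p, q) = (-q, p)\<close>
  and \<open>(x 4, x 3) = \<phi>\<close>, \<open>(x 0, x 1, x 2) = (\<lambda>, \<mu>, b)\<close>.\<close>

definition nilp_mat :: "(nat \<Rightarrow> complex) \<Rightarrow> nat \<Rightarrow> nat \<Rightarrow> complex" where
  "nilp_mat x j k = (if j = 1 then x 4 else x 3) * (if k = 1 then - x 3 else x 4)"

definition nilp :: "(nat \<Rightarrow> complex) \<Rightarrow> sstruct" where
  "nilp x = mk 0 (\<lambda>j k. x 0 * nilp_mat x j k) (\<lambda>j k. x 1 * nilp_mat x j k)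
    (\<lambda>i j. x 2 * ((if i = 1 then x 4 else x 3) * (if j = 1 then x 4 else x 3)))"

lemma mpf_if: "p \<in> mpf \<Longrightarrow> q \<in> mpf \<Longrightarrow> (\<lambda>x. if P then p x else q x) \<in> mpf"
  by (cases P) auto

lemma polymap_mk:
  assumes "a \<in> mpf" "\<And>i j. (\<lambda>x. L x i j) \<in> mpf" "\<And>i j. (\<lambda>x. M x i j) \<in> mpf" "\<And>i j. (\<lambda>x. B x i j) \<in> mpf"
  shows "polymap (\<lambda>x. mk (a x) (L x) (M x) (B x))"
  unfolding polymap_def
proof (intro conjI allI)
  show "(\<lambda>x. mk (a x) (L x) (M x) (B x) i j k) \<in> mpf" for i j k
    unfolding mk_def by (intro mpf_if assms mpf_const)
qed (rule mk_StructSpace)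

lemma polymap_cone: "polymap (cone a1 a2 b1 b2)"
  unfolding cone_def[abs_def] cone_mat_def cone_s_def
  by (intro polymap_mk mpf_intros mpf_if)

lemma polymap_forms: "polymap (forms n)"
  unfolding forms_def[abs_def] by (intro polymap_mk mpf_intros mpf_if)

lemma polymap_nilp: "polymap nilp"
  unfolding nilp_def[abs_def] nilp_mat_def by (intro polymap_mk mpf_intros mpf_if)

lemma tbl_eq_mk:
  "R04 \<alpha> = mk 0 (\<lambda>_ _. 0) (\<lambda>_ _. 0) (\<lambda>i j. if i = 1 \<and> j = 2 then \<alpha> + 1 else if i = 2 \<and> j = 1 then \<alpha> - 1 else 0)"
  "R07 \<alpha> = mk 0 (\<lambda>j k. if j = 1 \<and> k = 2 then 1 + \<alpha> else 0) (\<lambda>j k. if j = 1 \<and> k = 2 then 1 - \<alpha> else 0)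
    (\<lambda>i j. if i = 1 \<and> j = 1 then 1 else 0)"
  "R09 = unital 0 0 1 0" "R15 = unital 1 0 1 1" "R17 = unital 1 0 1 0"
  "R19 = unital 0 0 0 0" "R22 = unital 0 0 1 1" "R24 = unital 1 1 1 1"
  unfolding R04_def R07_def R09_def R15_def R17_def R19_def R22_def R24_def unital_def
  by (intro ext; simp add: tbl_def mk_def)+

section \<open>The families satisfy the graded identities\<close>

lemma is_binary_permI:
  assumes "\<And>dx dy dz x y z k. dx = 0 \<or> dx = 1 \<Longrightarrow> dy = 0 \<or> dy = 1 \<Longrightarrow> dz = 0 \<or> dz = 1 \<Longrightarrow>
      homog dx x \<Longrightarrow> homog dy y \<Longrightarrow> homog dz z \<Longrightarrow>
     assoc c x y z k = - sg (dy * dz) * assoc c x z y k \<and>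
     assoc c x y z k = - sg (dx * dy) * assoc c y x z k \<and>
     smul c (smul c x y) z k + sg (dx*dy + dx*dz + dy*dz) * smul c (smul c z y) x k
          = sg (dy*dz) * smul c (smul c x z) y k + sg (dx*dz + dy*dz) * smul c (smul c z x) y k"
  shows "is_binary_perm c"
proof -
  have d: "d = 0 \<or> d = 1" if "d < 2" for d :: nat using that by auto
  show ?thesis unfolding is_binary_perm_def
  proof (intro allI impI, elim conjE)
    fix dx dy dz x y z
    assume "dx < 2" "dy < 2" "dz < 2" and h: "homog dx x" "homog dy y" "homog dz z"
    note * = assms[OF d[OF this(1)] d[OF this(2)] d[OF this(3)] h]
    show "(\<forall>k. assoc c x y z k = - sg (dy * dz) * assoc c x z y k) \<and>
     (\<forall>k. assoc c x y z k = - sg (dx * dy) * assoc c y x z k) \<and>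
     (\<forall>k. smul c (smul c x y) z k + sg (dx*dy + dx*dz + dy*dz) * smul c (smul c z y) x k
          = sg (dy*dz) * smul c (smul c x z) y k + sg (dx*dz + dy*dz) * smul c (smul c z x) y k)"
      by (intro conjI allI; rule *[THEN conjunct1] *[THEN conjunct2, THEN conjunct1] *[THEN conjunct2, THEN conjunct2])
  qed
qed

definition lin2 :: "complex \<Rightarrow> complex \<Rightarrow> (nat \<Rightarrow> complex) \<Rightarrow> complex" where
  "lin2 p q y = p * y 1 + q * y 2"

lemma lin2_homog_0: "homog 0 y \<Longrightarrow> lin2 p q y = 0"
  by (simp add: lin2_def homog_0)

text \<open>The rows of the cone matrices diagonalise simultaneously: the functionals \<open>\<phi>\<close> and
  \<open>j = (-v\<^sub>2, v\<^sub>1)\<close> are dual, up to the factor \<open>s\<close>, to \<open>v\<close> and \<open>w = (-\<phi>\<^sub>2, \<phi>\<^sub>1)\<close>.\<close>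

lemma smul_cone:
  fixes x
  defines "\<phi> \<equiv> lin2 (x 2) (x 3)" and "j \<equiv> lin2 (- x 1) (x 0)"
  shows "smul (cone a1 a2 b1 b2 x) y z =
    (\<lambda>k. if k = 0 then cone_s x * y 0 * z 0
      else if k = 1 then x 0 * (a1 * y 0 * \<phi> z + b1 * z 0 * \<phi> y) - x 3 * (a2 * y 0 * j z + b2 * z 0 * j y)
      else if k = 2 then x 1 * (a1 * y 0 * \<phi> z + b1 * z 0 * \<phi> y) + x 2 * (a2 * y 0 * j z + b2 * z 0 * j y)
      else 0)"
  by (rule ext) (simp add: cone_def smul_mk cone_mat_def cone_s_def lin2_def \<phi>_def j_def algebra_simps)

text \<open>Because \<open>\<phi>(v) = j(w) = s\<close> and \<open>\<phi>(w) = j(v) = 0\<close>, the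
  two functionals see a product only through their own eigenvalues, so nested products never have to
  be multiplied out in coordinates.\<close>

lemma lin2_smul_cone:
  "lin2 (x 2) (x 3) (smul (cone a1 a2 b1 b2 x) y z) =
    cone_s x * (a1 * y 0 * lin2 (x 2) (x 3) z + b1 * z 0 * lin2 (x 2) (x 3) y)"
  "lin2 (- x 1) (x 0) (smul (cone a1 a2 b1 b2 x) y z) =
    cone_s x * (a2 * y 0 * lin2 (- x 1) (x 0) z + b2 * z 0 * lin2 (- x 1) (x 0) y)"
  by (simp_all add: smul_cone cone_s_def) (simp_all add: lin2_def algebra_simps)

lemma smul_cone_0: "smul (cone a1 a2 b1 b2 x) y z 0 = cone_s x * y 0 * z 0"
  by (simp add: smul_cone)

text \<open>Along the two eigenvectors the identities become conditions on each pair (left, right)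
  of eigenvalues. The missing pair (1,0) is the one that contradicts
  \<open>(e f) e = (e e) f\<close>.\<close>

lemma cone_in_PermVar:
  assumes "(a1, b1) \<in> {(0,0), (0,1), (1,1)}" "(a2, b2) \<in> {(0,0), (0,1), (1,1)}"
  shows "cone a1 a2 b1 b2 x \<in> PermVar"
proof -
  have "is_binary_perm (cone a1 a2 b1 b2 x)"
  proof (rule is_binary_permI)
    fix dx dy dz :: nat and y1 y2 y3 k
    assume d: "dx = 0 \<or> dx = 1" "dy = 0 \<or> dy = 1" "dz = 0 \<or> dz = 1"
      and h: "homog dx y1" "homog dy y2" "homog dz y3"
    \<comment> \<open>Only the component \<open>k\<close> matches, so unfolding expands the
      outermost product alone; inner products then occur only through component 0 and the two
      functionals.\<close>
    have outer: "smul (cone a1 a2 b1 b2 x) u v k = (if k = 0 then cone_s x * u 0 * v 0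
      else if k = 1 then x 0 * (a1 * u 0 * lin2 (x 2) (x 3) v + b1 * v 0 * lin2 (x 2) (x 3) u)
        - x 3 * (a2 * u 0 * lin2 (- x 1) (x 0) v + b2 * v 0 * lin2 (- x 1) (x 0) u)
      else if k = 2 then x 1 * (a1 * u 0 * lin2 (x 2) (x 3) v + b1 * v 0 * lin2 (x 2) (x 3) u)
        + x 2 * (a2 * u 0 * lin2 (- x 1) (x 0) v + b2 * v 0 * lin2 (- x 1) (x 0) u)
      else 0)" for u v
      by (simp add: smul_cone)
    have ab: "a1 = 0 \<and> b1 = 0 \<or> a1 = 0 \<and> b1 = 1 \<or> a1 = 1 \<and> b1 = 1"
      "a2 = 0 \<and> b2 = 0 \<or> a2 = 0 \<and> b2 = 1 \<or> a2 = 1 \<and> b2 = 1" using assms by auto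
    show "assoc (cone a1 a2 b1 b2 x) y1 y2 y3 k = - sg (dy * dz) * assoc (cone a1 a2 b1 b2 x) y1 y3 y2 k \<and>
     assoc (cone a1 a2 b1 b2 x) y1 y2 y3 k = - sg (dx * dy) * assoc (cone a1 a2 b1 b2 x) y2 y1 y3 k \<and>
     smul (cone a1 a2 b1 b2 x) (smul (cone a1 a2 b1 b2 x) y1 y2) y3 k
       + sg (dx*dy + dx*dz + dy*dz) * smul (cone a1 a2 b1 b2 x) (smul (cone a1 a2 b1 b2 x) y3 y2) y1 k
          = sg (dy*dz) * smul (cone a1 a2 b1 b2 x) (smul (cone a1 a2 b1 b2 x) y1 y3) y2 k
       + sg (dx*dz + dy*dz) * smul (cone a1 a2 b1 b2 x) (smul (cone a1 a2 b1 b2 x) y3 y1) y2 k"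
      unfolding assoc_def outer lin2_smul_cone smul_cone_0
      using d h ab by (elim disjE conjE) (simp_all add: sg_def lin2_homog_0 homog_1)
  qed
  thus ?thesis by (simp add: PermVar_def cone_def mk_StructSpace)
qed

text \<open>All products lie in the even line and the even line annihilates everything, so every
  triple product is zero.\<close>

lemma forms_in_PermVar: "forms n x \<in> PermVar"
proof -
  have "is_binary_perm (forms n x)"
    by (rule is_binary_permI) (simp add: forms_def assoc_def smul_mk)
  thus ?thesis by (simp add: PermVar_def forms_def mk_StructSpace)
qed

lemma smul_nilp:
  fixes x
  defines "\<phi> \<equiv> lin2 (x 4) (x 3)"
  shows "smul (nilp x) y z =
    (\<lambda>k. if k = 0 then x 2 * \<phi> y * \<phi> z
      else if k = 1 then - x 3 * (x 0 * y 0 * \<phi> z + x 1 * z 0 * \<phi> y)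
      else if k = 2 then x 4 * (x 0 * y 0 * \<phi> z + x 1 * z 0 * \<phi> y)
      else 0)"
  by (rule ext) (simp add: nilp_def smul_mk nilp_mat_def lin2_def \<phi>_def algebra_simps)

lemma lin2_smul_nilp: "lin2 (x 4) (x 3) (smul (nilp x) y z) = 0"
  unfolding lin2_def[of "x 4" "x 3" "smul _ _ _"] by (simp add: smul_nilp)

lemma smul_nilp_0: "smul (nilp x) y z 0 = x 2 * lin2 (x 4) (x 3) y * lin2 (x 4) (x 3) z"
  by (simp add: smul_nilp)

text \<open>The linear form vanishes on products, so the only possibly nonzero triple products have
  three odd factors. They are symmetric in these factors, as the graded signs demand.\<close>

lemma nilp_in_PermVar: "nilp x \<in> PermVar"
proof -
  have "is_binary_perm (nilp x)"
  proof (rule is_binary_permI)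
    fix dx dy dz :: nat and y1 y2 y3 k
    assume d: "dx = 0 \<or> dx = 1" "dy = 0 \<or> dy = 1" "dz = 0 \<or> dz = 1"
      and h: "homog dx y1" "homog dy y2" "homog dz y3"
    have outer: "smul (nilp x) u v k = (if k = 0 then x 2 * lin2 (x 4) (x 3) u * lin2 (x 4) (x 3) v
      else if k = 1 then - x 3 * (x 0 * u 0 * lin2 (x 4) (x 3) v + x 1 * v 0 * lin2 (x 4) (x 3) u)
      else if k = 2 then x 4 * (x 0 * u 0 * lin2 (x 4) (x 3) v + x 1 * v 0 * lin2 (x 4) (x 3) u)
      else 0)" for u v
      by (simp add: smul_nilp)
    show "assoc (nilp x) y1 y2 y3 k = - sg (dy * dz) * assoc (nilp x) y1 y3 y2 k \<and>
     assoc (nilp x) y1 y2 y3 k = - sg (dx * dy) * assoc (nilp x) y2 y1 y3 k \<and>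
     smul (nilp x) (smul (nilp x) y1 y2) y3 k + sg (dx*dy + dx*dz + dy*dz) * smul (nilp x) (smul (nilp x) y3 y2) y1 k
          = sg (dy*dz) * smul (nilp x) (smul (nilp x) y1 y3) y2 k + sg (dx*dz + dy*dz) * smul (nilp x) (smul (nilp x) y3 y1) y2 k"
      unfolding assoc_def outer lin2_smul_nilp smul_nilp_0
      using d h by (elim disjE) (simp_all add: sg_def lin2_homog_0 homog_1 mult_ac)
  qed
  thus ?thesis by (simp add: PermVar_def nilp_def mk_StructSpace)
qed

section \<open>The variety is Zariski closed\<close>

lemma zclosed_Collect_eq:
  assumes "p \<in> polyfun" "q \<in> polyfun"
  shows "zclosed {c \<in> StructSpace. p c = q c}"
  using zclosed_hypersurface[OF zclosed_StructSpace pf_diff[OF assms]] by simp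

lemma zclosed_Collect_all:
  assumes "\<And>i. zclosed {c \<in> StructSpace. Q i c}"
  shows "zclosed {c \<in> StructSpace. \<forall>i. Q i c}"
proof -
  have "\<forall>i. \<exists>P. P \<subseteq> polyfun \<and> {c \<in> StructSpace. Q i c} = {c \<in> StructSpace. \<forall>p\<in>P. p c = 0}"
    using assms by (simp add: zclosed_def)
  from choice[OF this] obtain P where P: "\<forall>i. P i \<subseteq> polyfun \<and>
    {c \<in> StructSpace. Q i c} = {c \<in> StructSpace. \<forall>p\<in>P i. p c = 0}" ..
  have "{c \<in> StructSpace. \<forall>i. Q i c} = {c \<in> StructSpace. \<forall>p\<in>(\<Union>i. P i). p c = 0}"
  proof (intro set_eqI)
    fix c
    have "c \<in> {c \<in> StructSpace. Q i c} \<longleftrightarrow> c \<in> {c \<in> StructSpace. \<forall>p\<in>P i. p c = 0}" for i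
      using P by simp
    thus "c \<in> {c \<in> StructSpace. \<forall>i. Q i c} \<longleftrightarrow> c \<in> {c \<in> StructSpace. \<forall>p\<in>(\<Union>i. P i). p c = 0}"
      by auto
  qed
  thus ?thesis unfolding zclosed_def using P by (intro exI[of _ "\<Union>i. P i"]) auto
qed

lemma zclosed_Collect_conj:
  assumes "zclosed {c \<in> StructSpace. Q c}" "zclosed {c \<in> StructSpace. R c}"
  shows "zclosed {c \<in> StructSpace. Q c \<and> R c}"
proof -
  have "zclosed {c \<in> StructSpace. \<forall>b. if b then Q c else R c}"
  proof (rule zclosed_Collect_all)
    show "zclosed {c \<in> StructSpace. if b then Q c else R c}" for b
      by (cases b) (use assms in simp_all)
  qed
  thus ?thesis by (simp add: all_bool_eq conj_commute)
qed

lemma zclosed_Collect_imp: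
  assumes "zclosed {c \<in> StructSpace. Q c}"
  shows "zclosed {c \<in> StructSpace. A \<longrightarrow> Q c}"
  using assms zclosed_StructSpace by (cases A) simp_all

lemma polyfun_smul:
  assumes "\<And>i. (\<lambda>c. p c i) \<in> polyfun" "\<And>i. (\<lambda>c. q c i) \<in> polyfun"
  shows "(\<lambda>c. smul c (p c) (q c) k) \<in> polyfun"
  unfolding smul_def using assms by (intro pf_intros)

text \<open>Each choice of homogeneous elements and of a component gives one polynomial equation in
  the structure constants; the infinitely many choices cause no trouble, as arbitrary intersections
  of closed sets are closed.\<close>

lemma zclosed_PermVar: "zclosed PermVar"
proof -
  have s: "(\<lambda>c. smul c (smul c x y) z k) \<in> polyfun" "(\<lambda>c. smul c x (smul c y z) k) \<in> polyfun" for x y z k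
    by (rule polyfun_smul, rule polyfun_smul pf_const, (rule pf_const)+)
      (rule polyfun_smul, rule pf_const, rule polyfun_smul, (rule pf_const)+)
  hence a: "(\<lambda>c. assoc c x y z k) \<in> polyfun" for x y z k
    unfolding assoc_def by (intro pf_diff)
  have e1: "zclosed {c \<in> StructSpace. assoc c x y z k = r * assoc c x' y' z' k}" for x y z x' y' z' k r
    by (rule zclosed_Collect_eq[OF a pf_mult[OF pf_const a]])
  have e2: "zclosed {c \<in> StructSpace. smul c (smul c x y) z k + r * smul c (smul c x' y') z' k =
      r' * smul c (smul c x1 y1) z1 k + r'' * smul c (smul c x2 y2) z2 k}"
    for x y z x' y' z' x1 y1 z1 x2 y2 z2 k r r' r''
    by (rule zclosed_Collect_eq[OF pf_add[OF s(1) pf_mult[OF pf_const s(1)]]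
        pf_add[OF pf_mult[OF pf_const s(1)] pf_mult[OF pf_const s(1)]]])
  show ?thesis
    unfolding PermVar_def is_binary_perm_def
    by (intro zclosed_Collect_all zclosed_Collect_imp zclosed_Collect_conj e1 e2)
qed

section \<open>Orbits\<close>

definition blk :: "complex \<Rightarrow> complex \<Rightarrow> complex \<Rightarrow> complex \<Rightarrow> complex \<Rightarrow> nat \<Rightarrow> nat \<Rightarrow> complex" where
  "blk g p q r t i j = (if i = 0 \<and> j = 0 then g else if i = 1 \<and> j = 1 then p else if i = 1 \<and> j = 2 then q
    else if i = 2 \<and> j = 1 then r else if i = 2 \<and> j = 2 then t else 0)"

lemma blk_simps:
  "blk g p q r t 0 0 = g" "blk g p q r t 1 1 = p" "blk g p q r t 1 2 = q"
  "blk g p q r t 2 1 = r" "blk g p q r t 2 2 = t"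
  by (simp_all add: blk_def)

lemma gl_pair_blk:
  assumes "g * g' = 1"
    "p * p' + q * r' = 1" "p * q' + q * t' = 0" "r * p' + t * r' = 0" "r * q' + t * t' = 1"
    "p' * p + q' * r = 1" "p' * q + q' * t = 0" "r' * p + t' * r = 0" "r' * q + t' * t = 1"
  shows "gl_pair (blk g p q r t) (blk g' p' q' r' t')"
  using assms unfolding gl_pair_def by (simp add: all_less_3 sum_less_3 blk_def par_def mult.commute[of g' g])

lemma orbit_unital: "orbit (unital a1 a2 b1 b2) = cone a1 a2 b1 b2 ` {x. cone_s x \<noteq> 0}"
proof (intro set_eqI iffI)
  fix c assume "c \<in> orbit (unital a1 a2 b1 b2)"
  then obtain G H where GH: "gl_pair G H" "c = act G H (unital a1 a2 b1 b2)" by (auto simp: orbit_def)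
  note e = gl_pair_eqs[OF GH(1)]
  \<comment> \<open>\<open>v\<close> is the first odd column of \<open>G\<close>, the image of
    \<open>f_1\<close>; the functional is \<open>H 0 0\<close> times the first odd row of
    \<open>H\<close>, so that its value at \<open>v\<close> is \<open>H 0 0\<close>.\<close>
  define x :: "nat \<Rightarrow> complex" where "x = (\<lambda>_. 0)(0 := G 1 1, 1 := G 2 1, 2 := H 0 0 * H 1 1, 3 := H 0 0 * H 1 2)"
  have x: "x 0 = G 1 1" "x 1 = G 2 1" "x 2 = H 0 0 * H 1 1" "x 3 = H 0 0 * H 1 2"
    by (simp_all add: x_def)
  have "cone_s x = H 0 0 * (H 1 1 * G 1 1 + H 1 2 * G 2 1)" by (simp add: cone_s_def x algebra_simps)
  hence s: "cone_s x = H 0 0" using e by simp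
  have g: "G 1 2 * H 2 1 = 1 - G 1 1 * H 1 1" "G 1 2 * H 2 2 = - G 1 1 * H 1 2"
    "G 2 2 * H 2 1 = - G 2 1 * H 1 1" "G 2 2 * H 2 2 = 1 - G 2 1 * H 1 2"
    using e(11-14) by (simp_all add: algebra_simps eq_neg_iff_add_eq_0)
  have m: "H 0 0 * (\<Sum>b\<in>{1,2}. \<Sum>l\<in>{1,2}. H b j * (if b = l then if b = 1 then a else a' else 0) * G k l) =
    cone_mat a a' x j k" if "j \<in> {1,2}" "k \<in> {1,2}" for j k a a'
  proof -
    have "H 0 0 * (\<Sum>b\<in>{1,2}. \<Sum>l\<in>{1,2}. H b j * (if b = l then if b = 1 then a else a' else 0) * G k l) =
      H 0 0 * (a * (G k 1 * H 1 j) + a' * (G k 2 * H 2 j))" by (simp add: algebra_simps)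
    also have "\<dots> = cone_mat a a' x j k"
      using that by (elim insertE; simp add: g cone_mat_def s x; simp add: algebra_simps)
    finally show ?thesis .
  qed
  have "c = cone a1 a2 b1 b2 x"
    unfolding GH(2) unital_def act_mk[OF GH(1)] cone_def by (rule mk_eqI) (auto simp only: s m, auto)
  moreover have "H 0 0 \<noteq> 0" using e(1) by auto
  ultimately show "c \<in> cone a1 a2 b1 b2 ` {x. cone_s x \<noteq> 0}" using s by auto
next
  fix c assume "c \<in> cone a1 a2 b1 b2 ` {x. cone_s x \<noteq> 0}"
  then obtain x where x: "c = cone a1 a2 b1 b2 x" "cone_s x \<noteq> 0" by auto
  define s where "s = cone_s x"
  have s: "s \<noteq> 0" "x 0 * x 2 + x 1 * x 3 = s" using x by (auto simp: s_def cone_s_def)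
  \<comment> \<open>The odd columns of \<open>?G\<close> are the eigenvectors \<open>v\<close> and
    \<open>w = (- x 3, x 2)\<close>; the odd rows of \<open>?H\<close> are the dual functionals
    divided by \<open>s\<close>.\<close>
  let ?G = "blk (1 / s) (x 0) (- x 3) (x 1) (x 2)"
  let ?H = "blk s (x 2 / s) (x 3 / s) (- x 1 / s) (x 0 / s)"
  have gl: "gl_pair ?G ?H"
    by (rule gl_pair_blk) (use s in \<open>auto simp: field_simps\<close>)
  have "act ?G ?H (unital a1 a2 b1 b2) = c"
    unfolding unital_def act_mk[OF gl] x(1) cone_def s_def[symmetric]
  proof (rule mk_eqI)
    have m: "s * (\<Sum>b\<in>{1,2}. \<Sum>l\<in>{1,2}. ?H b j * (if b = l then if b = 1 then a else a' else 0) * ?G k l) =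
      cone_mat a a' x j k" if "j \<in> {1,2}" "k \<in> {1,2}" for j k a a'
      using that s(1) by (elim insertE; simp add: blk_simps cone_mat_def s_def[symmetric] field_simps;
          simp add: s(2)[symmetric] algebra_simps)
    show "?H 0 0 * (\<Sum>b\<in>{1,2}. \<Sum>l\<in>{1,2}. ?H b j * (if b = l then if b = 1 then a1 else a2 else 0) * ?G k l) =
      cone_mat a1 a2 x j k"
      "?H 0 0 * (\<Sum>b\<in>{1,2}. \<Sum>l\<in>{1,2}. ?H b j * (if b = l then if b = 1 then b1 else b2 else 0) * ?G k l) =
      cone_mat b1 b2 x j k" if "j \<in> {1,2}" "k \<in> {1,2}" for j k
      unfolding blk_simps by (rule m[OF that])+
  qed (simp_all add: blk_simps)
  from this[symmetric] gl show "c \<in> orbit (unital a1 a2 b1 b2)" unfolding orbit_def by blast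
qed

lemma orbit_R04_subset: "orbit (R04 \<alpha>) \<subseteq> range (forms 4)"
proof
  fix c assume "c \<in> orbit (R04 \<alpha>)"
  then obtain G H where GH: "gl_pair G H" "c = act G H (R04 \<alpha>)" by (auto simp: orbit_def)
  obtain B where B: "c = mk 0 (\<lambda>_ _. 0) (\<lambda>_ _. 0) B"
    using GH(2) unfolding tbl_eq_mk act_mk[OF GH(1)] by simp
  have "c = forms 4 ((\<lambda>_. 0)(0 := B 1 1, 1 := B 1 2, 2 := B 2 1, 3 := B 2 2))"
    unfolding B forms_def by (rule mk_eqI) (auto simp: form_idx_def)
  thus "c \<in> range (forms 4)" by blast
qed

text \<open>The factors say that the quadratic form has a leading term, that its alternating part is
  nonzero (it is a fixed nonzero form in \<open>R04\<close>, and is matched by scaling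
  \<open>e\<close>), and that its discriminant is nonzero.\<close>

definition forms_generic :: "(nat \<Rightarrow> complex) \<Rightarrow> complex" where
  "forms_generic x = x 0 * (x 1 - x 2) * ((x 1 + x 2) ^ 2 - 4 * x 0 * x 3)"

text \<open>A form whose symmetric part is \<open>x\<^sub>0\<close> times a product of two distinct linear forms is brought
  to the shape of \<open>R04 \<alpha>\<close> by taking those linear forms as coordinates.\<close>

lemma forms_generic_orbit:
  assumes "forms_generic x \<noteq> 0"
  shows "\<exists>\<alpha>. forms 4 x \<in> orbit (R04 \<alpha>)"
proof -
  define d where "d = csqrt ((x 1 + x 2) ^ 2 - 4 * x 0 * x 3)"
  have d: "d ^ 2 = (x 1 + x 2) ^ 2 - 4 * x 0 * x 3" by (simp add: d_def)
  have nz: "x 0 \<noteq> 0" "x 1 - x 2 \<noteq> 0" "d \<noteq> 0" using assms d by (auto simp: forms_generic_def)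
  \<comment> \<open>The roots of \<open>x 0 * r^2 + (x 1 + x 2) * r + x 3\<close>; the new
    coordinates are the linear forms \<open>y_1 - r1 y_2\<close> and \<open>y_1 - r2 y_2\<close>,
    the odd rows of \<open>?H\<close>.\<close>
  define r1 r2 where "r1 = (- (x 1 + x 2) + d) / (2 * x 0)" and "r2 = (- (x 1 + x 2) - d) / (2 * x 0)"
  define D where "D = r1 - r2"
  have "D = d / x 0" using nz by (simp add: D_def r1_def r2_def field_simps)
  hence D: "D \<noteq> 0" using nz by simp
  have sum: "x 0 * (r1 + r2) = - (x 1 + x 2)" using nz by (simp add: r1_def r2_def field_simps)
  have "4 * x 0 * (x 0 * (r1 * r2)) = (x 1 + x 2) ^ 2 - d ^ 2"
    using nz by (simp add: r1_def r2_def field_simps power2_eq_square)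
  hence prod: "x 0 * (r1 * r2) = x 3" using nz unfolding d by simp
  \<comment> \<open>\<open>g\<close> is forced by the alternating part, since the products of
    \<open>R04\<close> differ by 2 and the coordinate change contributes the factor
    \<open>D\<close>; \<open>\<alpha>\<close> is then forced by the entry
    \<open>x 0\<close>.\<close>
  define g where "g = (x 1 - x 2) / (2 * D)"
  have g: "g \<noteq> 0" "2 * (g * D) = x 1 - x 2" using nz D by (simp_all add: g_def)
  define \<alpha> where "\<alpha> = x 0 / (2 * g)"
  have \<alpha>: "2 * (g * \<alpha>) = x 0" using g by (simp add: \<alpha>_def)
  let ?G = "blk g (- r2 / D) (r1 / D) (- 1 / D) (1 / D)"
  let ?H = "blk (1 / g) 1 (- r1) 1 (- r2)"
  have gl: "gl_pair ?G ?H"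
    by (rule gl_pair_blk) (use D g in \<open>simp_all add: field_simps\<close>, simp_all add: D_def)
  have "g * (\<alpha> + 1 + (\<alpha> - 1)) = x 0" using \<alpha> by (simp add: algebra_simps)
  moreover have "g * (- ((\<alpha> + 1) * r2) - (\<alpha> - 1) * r1) = x 1"
  proof -
    have "2 * (g * (- ((\<alpha> + 1) * r2) - (\<alpha> - 1) * r1)) = - (2 * (g * \<alpha>)) * (r1 + r2) + 2 * (g * D)"
      by (simp add: D_def algebra_simps)
    also have "\<dots> = 2 * x 1" unfolding \<alpha> g using sum by (simp add: algebra_simps)
    finally show ?thesis by simp
  qed
  moreover have "g * (- ((\<alpha> + 1) * r1) - (\<alpha> - 1) * r2) = x 2"
  proof -
    have "2 * (g * (- ((\<alpha> + 1) * r1) - (\<alpha> - 1) * r2)) = - (2 * (g * \<alpha>)) * (r1 + r2) - 2 * (g * D)"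
      by (simp add: D_def algebra_simps)
    also have "\<dots> = 2 * x 2" unfolding \<alpha> g using sum by (simp add: algebra_simps)
    finally show ?thesis by simp
  qed
  moreover have "g * ((\<alpha> + 1) * (r1 * r2) + (\<alpha> - 1) * (r1 * r2)) = x 3"
  proof -
    have "g * ((\<alpha> + 1) * (r1 * r2) + (\<alpha> - 1) * (r1 * r2)) = 2 * (g * \<alpha>) * (r1 * r2)"
      by (simp add: algebra_simps)
    thus ?thesis unfolding \<alpha> using prod by simp
  qed
  ultimately have "act ?G ?H (R04 \<alpha>) = forms 4 x"
    unfolding tbl_eq_mk act_mk[OF gl] forms_def
    by (intro mk_eqI) (auto simp: blk_simps form_idx_def algebra_simps)
  from this[symmetric] gl show ?thesis unfolding orbit_def by blast
qed

lemma orbit_R07_subset: "orbit (R07 \<alpha>) \<subseteq> range nilp"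
proof
  fix c assume "c \<in> orbit (R07 \<alpha>)"
  then obtain G H where GH: "gl_pair G H" "c = act G H (R07 \<alpha>)" by (auto simp: orbit_def)
  note e = gl_pair_eqs[OF GH(1)]
  \<comment> \<open>The determinant of the odd block. By Cramer's rule the second column of
    \<open>G\<close> is \<open>t\<close> times the rotated first row of \<open>H\<close>, which
    yields the shape \<open>\<phi>\<close> times \<open>J\<phi>\<close>.\<close>
  define t where "t = G 1 1 * G 2 2 - G 1 2 * G 2 1"
  have "t * H 1 1 = G 2 2 * (G 1 1 * H 1 1 + G 1 2 * H 2 1) - G 1 2 * (G 2 1 * H 1 1 + G 2 2 * H 2 1)"
    by (simp add: t_def algebra_simps)
  hence G22: "G 2 2 = t * H 1 1" using e by simp
  have "t * H 1 2 = G 2 2 * (G 1 1 * H 1 2 + G 1 2 * H 2 2) - G 1 2 * (G 2 1 * H 1 2 + G 2 2 * H 2 2)"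
    by (simp add: t_def algebra_simps)
  hence G12: "G 1 2 = - (t * H 1 2)" using e by simp
  have "c = nilp ((\<lambda>_. 0)(0 := H 0 0 * (1 + \<alpha>) * t, 1 := H 0 0 * (1 - \<alpha>) * t, 2 := G 0 0, 3 := H 1 2, 4 := H 1 1))"
    unfolding GH(2) tbl_eq_mk act_mk[OF GH(1)] nilp_def nilp_mat_def
    by (rule mk_eqI) (auto simp: G12 G22 algebra_simps)
  thus "c \<in> range nilp" by blast
qed

text \<open>\<open>x 4\<close> allows a triangular change of basis, \<open>x 2\<close> is scaled to
  \<open>f_1 f_1 = e_1\<close>, and \<open>x 0 + x 1\<close> must be nonzero because the
  coefficients \<open>1 + \<alpha>\<close> and \<open>1 - \<alpha>\<close> of \<open>R07\<close> add
  up to 2.\<close>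

definition nilp_generic :: "(nat \<Rightarrow> complex) \<Rightarrow> complex" where
  "nilp_generic x = x 4 * (x 0 + x 1) * x 2"

lemma nilp_generic_orbit:
  assumes "nilp_generic x \<noteq> 0"
  shows "\<exists>\<alpha>. nilp x \<in> orbit (R07 \<alpha>)"
proof -
  have nz: "x 4 \<noteq> 0" "x 0 + x 1 \<noteq> 0" "x 2 \<noteq> 0" using assms by (auto simp: nilp_generic_def)
  \<comment> \<open>Determined by adding the two equations required below,
    \<open>x 0 = (1 + \<alpha>) * t / x 2\<close> and
    \<open>x 1 = (1 - \<alpha>) * t / x 2\<close>.\<close>
  define t where "t = x 2 * (x 0 + x 1) / 2"
  have t: "t \<noteq> 0" using nz by (simp add: t_def)
  define \<alpha> where "\<alpha> = (x 0 - x 1) / (x 0 + x 1)"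
  have l: "x 0 = (1 + \<alpha>) * t / x 2" "x 1 = (1 - \<alpha>) * t / x 2"
  proof -
    have "1 + \<alpha> = 2 * x 0 / (x 0 + x 1)" "1 - \<alpha> = 2 * x 1 / (x 0 + x 1)"
      using nz by (simp_all add: \<alpha>_def field_simps)
    thus "x 0 = (1 + \<alpha>) * t / x 2" "x 1 = (1 - \<alpha>) * t / x 2"
      using nz by (simp_all add: t_def)
  qed
  let ?G = "blk (x 2) (1 / x 4) (- t * x 3) 0 (t * x 4)"
  let ?H = "blk (1 / x 2) (x 4) (x 3) 0 (1 / (t * x 4))"
  have gl: "gl_pair ?G ?H"
    by (rule gl_pair_blk) (use nz t in \<open>simp_all add: field_simps\<close>)
  have "act ?G ?H (R07 \<alpha>) = nilp x"
    unfolding tbl_eq_mk act_mk[OF gl] nilp_def nilp_mat_def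
    by (rule mk_eqI) (use nz(1,3) in \<open>auto simp: blk_simps l mult_ac\<close>)
  from this[symmetric] gl show ?thesis unfolding orbit_def by blast
qed

section \<open>Classification\<close>

definition ev :: "nat \<Rightarrow> nat \<Rightarrow> complex" where
  "ev i = (\<lambda>j. if j = i then 1 else 0)"

lemma homog_ev: "i < 3 \<Longrightarrow> homog (par i) (ev i)"
  by (auto simp: homog_def ev_def)

lemma smul_ev_left: "i < 3 \<Longrightarrow> smul c (ev i) y k = (\<Sum>j<3. y j * c i j k)"
  by (cases rule: nat_cases_3[of i]) (simp_all add: smul_def ev_def sum_less_3)

lemma smul_ev_right: "j < 3 \<Longrightarrow> smul c x (ev j) k = (\<Sum>i<3. x i * c i j k)"
  by (cases rule: nat_cases_3[of j]) (simp_all add: smul_def ev_def sum_less_3)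

lemma smul_ev: "i < 3 \<Longrightarrow> j < 3 \<Longrightarrow> smul c (ev i) (ev j) = c i j"
  by (rule ext, simp only: smul_ev_left, cases rule: nat_cases_3[of j]) (simp_all add: ev_def sum_less_3)

lemma assoc_ev:
  assumes "i < 3" "j < 3" "k < 3"
  shows "assoc c (ev i) (ev j) (ev k) l = (\<Sum>p<3. c i j p * c p k l) - (\<Sum>p<3. c j k p * c i p l)"
  using assms by (simp add: assoc_def smul_ev, simp add: smul_ev_left smul_ev_right)

lemma StructSpace_zero:
  assumes "c \<in> StructSpace"
  shows "c 0 0 1 = 0" "c 0 0 2 = 0" "i \<in> {1,2} \<Longrightarrow> c 0 i 0 = 0" "i \<in> {1,2} \<Longrightarrow> c i 0 0 = 0"
    "i \<in> {1,2} \<Longrightarrow> j \<in> {1,2} \<Longrightarrow> k \<in> {1,2} \<Longrightarrow> c i j k = 0"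
proof -
  have z: "c i j k = 0" if "par k \<noteq> (par i + par j) mod 2" for i j k
    using assms that unfolding StructSpace_def by blast
  show "c 0 0 1 = 0" "c 0 0 2 = 0" "i \<in> {1,2} \<Longrightarrow> c 0 i 0 = 0" "i \<in> {1,2} \<Longrightarrow> c i 0 0 = 0"
    "i \<in> {1,2} \<Longrightarrow> j \<in> {1,2} \<Longrightarrow> k \<in> {1,2} \<Longrightarrow> c i j k = 0"
    by (rule z; auto simp: par_def)+
qed

lemma eq_neg_self: "x = - x \<Longrightarrow> x = (0 :: complex)"
  by (simp add: eq_neg_iff_add_eq_0 mult_2[symmetric])

text \<open>\<open>U\<close>, \<open>X\<close>, \<open>W\<close>, \<open>Y\<close> are the values of
  \<open>B\<close> at \<open>(L f_i, f_j)\<close>, \<open>(M f_i, f_j)\<close>,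
  \<open>(f_i, M f_j)\<close>, \<open>(f_i, L f_j)\<close>. The four operator relations express that
  the associators \<open>(e,e,f)\<close>, \<open>(f,e,e)\<close>, \<open>(e,f,e)\<close> vanish and
  that \<open>(e e) f = (e f) e\<close>.\<close>

lemma PermVar_eqs:
  fixes c
  defines "a \<equiv> c 0 0 0"
  defines "U \<equiv> \<lambda>i j. c 0 i 1 * c 1 j 0 + c 0 i 2 * c 2 j 0"
  defines "X \<equiv> \<lambda>i j. c i 0 1 * c 1 j 0 + c i 0 2 * c 2 j 0"
  defines "W \<equiv> \<lambda>i j. c j 0 1 * c i 1 0 + c j 0 2 * c i 2 0"
  defines "Y \<equiv> \<lambda>i j. c 0 j 1 * c i 1 0 + c 0 j 2 * c i 2 0"
  assumes c: "c \<in> PermVar" and ijk: "i \<in> {1,2}" "j \<in> {1,2}" "k \<in> {1,2}"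
  shows "c 0 i 1 * c 0 1 k + c 0 i 2 * c 0 2 k = a * c 0 i k"
    and "c i 0 1 * c 1 0 k + c i 0 2 * c 2 0 k = a * c i 0 k"
    and "c 0 i 1 * c 1 0 k + c 0 i 2 * c 2 0 k = a * c 0 i k"
    and "c i 0 1 * c 0 1 k + c i 0 2 * c 0 2 k = a * c 0 i k"
    and "U i j - a * c i j 0 = U j i - a * c j i 0"
    and "a * c i j 0 - W i j = U i j - a * c i j 0"
    and "X i j - Y i j = - (U i j - a * c i j 0)"
    and "U i j + U j i + X i j = a * c i j 0"
    and "h \<in> {1,2} \<Longrightarrow> c i j 0 * c 0 h k - c j h 0 * c i 0 k = c i h 0 * c 0 j k - c h j 0 * c i 0 k"
    and "h \<in> {1,2} \<Longrightarrow> c i j 0 * c 0 h k - c h j 0 * c 0 i k = (c h i 0 - c i h 0) * c 0 j k"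
proof -
  have S: "c \<in> StructSpace" and P: "is_binary_perm c" using c by (auto simp: PermVar_def)
  note z = StructSpace_zero[OF S]
  \<comment> \<open>\<open>T1\<close> and \<open>T2\<close> hold the coefficients of the left and
    right bracketing of three basis vectors; \<open>A\<close> lists the axioms on such
    triples.\<close>
  define T1 where "T1 i j k l = (\<Sum>p<3. c i j p * c p k l)" for i j k l
  define T2 where "T2 i j k l = (\<Sum>p<3. c j k p * c i p l)" for i j k l
  have A: "T1 i j k l - T2 i j k l = - sg (par j * par k) * (T1 i k j l - T2 i k j l)"
    "T1 i j k l - T2 i j k l = - sg (par i * par j) * (T1 j i k l - T2 j i k l)"
    "T1 i j k l + sg (par i * par j + par i * par k + par j * par k) * T1 k j i l =
      sg (par j * par k) * T1 i k j l + sg (par i * par k + par j * par k) * T1 k i j l"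
    if "i < 3" "j < 3" "k < 3" for i j k l
  proof -
    have p: "par i < 2" "par j < 2" "par k < 2" by (auto simp: par_def)
    have ss: "smul c (smul c (ev i) (ev j)) (ev k) l = T1 i j k l" if "i < 3" "j < 3" "k < 3" for i j k
      using that unfolding T1_def by (simp only: smul_ev) (simp only: smul_ev_right)
    have as: "assoc c (ev i) (ev j) (ev k) l = T1 i j k l - T2 i j k l" if "i < 3" "j < 3" "k < 3" for i j k
      unfolding T1_def T2_def by (rule assoc_ev[OF that])
    note Q = P[unfolded is_binary_perm_def, rule_format, OF conjI[OF p(1) conjI[OF p(2) conjI[OF p(3)
      conjI[OF homog_ev[OF that(1)] conjI[OF homog_ev[OF that(2)] homog_ev[OF that(3)]]]]]]]
    show "T1 i j k l - T2 i j k l = - sg (par j * par k) * (T1 i k j l - T2 i k j l)"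
      using Q[THEN conjunct1, rule_format, of l] that by (simp only: as)
    show "T1 i j k l - T2 i j k l = - sg (par i * par j) * (T1 j i k l - T2 j i k l)"
      using Q[THEN conjunct2, THEN conjunct1, rule_format, of l] that by (simp only: as)
    show "T1 i j k l + sg (par i * par j + par i * par k + par j * par k) * T1 k j i l =
      sg (par j * par k) * T1 i k j l + sg (par i * par k + par j * par k) * T1 k i j l"
      using Q[THEN conjunct2, THEN conjunct2, rule_format, of l] that by (simp only: ss)
  qed
  have lt: "i < 3" "j < 3" "k < 3" "(0::nat) < 3" using ijk by auto
  have par: "par 0 = 0" "par i = 1" "par j = 1" "par k = 1" using ijk by (auto simp: par_def)
  note zi = z(1,2) z(3)[OF ijk(1)] z(3)[OF ijk(2)] z(3)[OF ijk(3)] z(4)[OF ijk(1)] z(4)[OF ijk(2)] z(4)[OF ijk(3)]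
  have zz: "c p q r = 0" if "p = i \<or> p = j \<or> p = k \<or> p = 1 \<or> p = 2" "q = i \<or> q = j \<or> q = k \<or> q = 1 \<or> q = 2"
    "r = i \<or> r = j \<or> r = k \<or> r = 1 \<or> r = 2" for p q r
    by (rule z(5)) (use that ijk in blast)+
  note d = T1_def T2_def sum_less_3 zi z(3,4)[of 1] z(3,4)[of 2] zz par sg_def a_def U_def X_def W_def Y_def
  show "c 0 i 1 * c 0 1 k + c 0 i 2 * c 0 2 k = a * c 0 i k"
    using eq_neg_self[of "T1 0 0 i k - T2 0 0 i k"] A(2)[OF lt(4) lt(4) lt(1), of k]
    by (simp add: par sg_def) (simp add: d)
  show "c i 0 1 * c 1 0 k + c i 0 2 * c 2 0 k = a * c i 0 k"
    using eq_neg_self[of "T1 i 0 0 k - T2 i 0 0 k"] A(1)[OF lt(1) lt(4) lt(4), of k]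
    by (simp add: par sg_def) (simp add: d)
  show 3: "c 0 i 1 * c 1 0 k + c 0 i 2 * c 2 0 k = a * c 0 i k"
    using A(3)[OF lt(4) lt(4) lt(1), of k] by (simp add: d)
  have "T1 0 0 i k - T2 0 0 i k = 0"
    using eq_neg_self[of "T1 0 0 i k - T2 0 0 i k"] A(2)[OF lt(4) lt(4) lt(1), of k]
    by (simp add: par sg_def)
  hence "T1 0 i 0 k - T2 0 i 0 k = 0"
    using A(1)[OF lt(4) lt(1) lt(4), of k] by (simp add: par sg_def)
  thus "c i 0 1 * c 0 1 k + c i 0 2 * c 0 2 k = a * c 0 i k"
    using 3 by (simp add: d)
  show "U i j - a * c i j 0 = U j i - a * c j i 0"
    using A(1)[OF lt(4) lt(1) lt(2), of 0] by (simp add: d mult.commute)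
  show "a * c i j 0 - W i j = U i j - a * c i j 0"
  proof -
    have "T1 i j 0 0 - T2 i j 0 0 = T1 0 i j 0 - T2 0 i j 0"
      using A(1)[OF lt(1) lt(2) lt(4), of 0] A(2)[OF lt(1) lt(4) lt(2), of 0] by (simp add: par sg_def)
    thus ?thesis by (simp add: d mult.commute)
  qed
  show "X i j - Y i j = - (U i j - a * c i j 0)"
    using A(2)[OF lt(1) lt(4) lt(2), of 0] by (simp add: d algebra_simps)
  show "U i j + U j i + X i j = a * c i j 0"
    using A(3)[OF lt(1) lt(2) lt(4), of 0] by (simp add: d algebra_simps)
  assume h: "h \<in> {1,2}"
  hence lth: "h < 3" and parh: "par h = 1" by (auto simp: par_def)
  show "c i j 0 * c 0 h k - c j h 0 * c i 0 k = c i h 0 * c 0 j k - c h j 0 * c i 0 k"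
    using A(1)[OF lt(1) lt(2) lth, of k] h by (simp add: d parh)
  show "c i j 0 * c 0 h k - c h j 0 * c 0 i k = (c h i 0 - c i h 0) * c 0 j k"
    using A(3)[OF lt(1) lt(2) lth, of k] h by (simp add: d parh algebra_simps)
qed

text \<open>In operator form the degree-two identities give \<open>B(L f, g) = B(f, M g) = B(f, L g) = B(M f, g) = a B(f, g)\<close>
  when \<open>a \<noteq> 0\<close>, whence \<open>B\<close> is alternating; if it were nonzero, \<open>L = M = a\<close>, contradicting the
  degree-three identity.\<close>

lemma PermVar_unital_form_zero:
  assumes c: "c \<in> PermVar" and a: "c 0 0 0 \<noteq> 0" and ij: "i \<in> {1,2}" "j \<in> {1,2}"
  shows "c i j 0 = 0"
proof -
  let ?a = "c 0 0 0"
  define U X W Y where "U i j = c 0 i 1 * c 1 j 0 + c 0 i 2 * c 2 j 0"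
    and "X i j = c i 0 1 * c 1 j 0 + c i 0 2 * c 2 j 0"
    and "W i j = c j 0 1 * c i 1 0 + c j 0 2 * c i 2 0"
    and "Y i j = c 0 j 1 * c i 1 0 + c 0 j 2 * c i 2 0" for i j
  have one: "(1::nat) \<in> {1,2}" "(2::nat) \<in> {1,2}" by auto
  note E = PermVar_eqs[OF c]
  have W: "W i j = 2 * ?a * c i j 0 - U i j" if "i \<in> {1,2}" "j \<in> {1,2}" for i j
    using E(6)[OF that one(1)] unfolding U_def W_def by (simp add: algebra_simps)
  \<comment> \<open>In \<open>W = 2 a B - U\<close>, replacing \<open>f\<close> by
    \<open>L f\<close> gives \<open>B(L f, M g) = a U\<close>, and replacing \<open>g\<close> by
    \<open>M g\<close> gives \<open>B(L f, M g) = a W\<close>. So \<open>U = W\<close>, and both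
    equal \<open>a B\<close>.\<close>
  have UW: "U i j = ?a * c i j 0" "W i j = ?a * c i j 0" if "i \<in> {1,2}" "j \<in> {1,2}" for i j
  proof -
    have "c 0 i 1 * U 1 j + c 0 i 2 * U 2 j =
      (c 0 i 1 * c 0 1 1 + c 0 i 2 * c 0 2 1) * c 1 j 0 + (c 0 i 1 * c 0 1 2 + c 0 i 2 * c 0 2 2) * c 2 j 0"
      by (simp add: U_def algebra_simps)
    hence LU: "c 0 i 1 * U 1 j + c 0 i 2 * U 2 j = ?a * U i j"
      unfolding E(1)[OF that one(1)] E(1)[OF that one(2)] by (simp add: U_def algebra_simps)
    have "c 0 i 1 * W 1 j + c 0 i 2 * W 2 j = 2 * ?a * U i j - (c 0 i 1 * U 1 j + c 0 i 2 * U 2 j)"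
      unfolding W[OF one(1) that(2)] W[OF one(2) that(2)] by (simp add: U_def algebra_simps)
    hence LW: "c 0 i 1 * W 1 j + c 0 i 2 * W 2 j = ?a * U i j"
      unfolding LU by (simp add: algebra_simps)
    have "c j 0 1 * W i 1 + c j 0 2 * W i 2 =
      (c j 0 1 * c 1 0 1 + c j 0 2 * c 2 0 1) * c i 1 0 + (c j 0 1 * c 1 0 2 + c j 0 2 * c 2 0 2) * c i 2 0"
      by (simp add: W_def algebra_simps)
    hence MW: "c j 0 1 * W i 1 + c j 0 2 * W i 2 = ?a * W i j"
      unfolding E(2)[OF that(2,1) one(1)] E(2)[OF that(2,1) one(2)] by (simp add: W_def algebra_simps)
    have "c j 0 1 * W i 1 + c j 0 2 * W i 2 = 2 * ?a * W i j - (c j 0 1 * U i 1 + c j 0 2 * U i 2)"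
      unfolding W[OF that(1) one(1)] W[OF that(1) one(2)] by (simp add: W_def algebra_simps)
    moreover have "c j 0 1 * U i 1 + c j 0 2 * U i 2 = c 0 i 1 * W 1 j + c 0 i 2 * W 2 j"
      by (simp add: U_def W_def algebra_simps)
    ultimately have "?a * W i j = ?a * U i j" unfolding MW LW by (simp add: algebra_simps)
    hence "W i j = U i j" using a by simp
    thus "U i j = ?a * c i j 0" "W i j = ?a * c i j 0"
      using W[OF that] by (simp_all add: algebra_simps)
  qed
  have XY: "X i j = Y i j" if "i \<in> {1,2}" "j \<in> {1,2}" for i j
    using E(7)[OF that one(1)] UW(1)[OF that] unfolding X_def Y_def U_def by simp
  \<comment> \<open>Putting \<open>L f\<close> into \<open>X = Y\<close> gives
    \<open>B(M L f, g) = B(L f, L g)\<close>, whose left side is \<open>a U\<close> and whose right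
    side is \<open>a Y\<close>.\<close>
  have Y: "Y i j = ?a * c i j 0" if "i \<in> {1,2}" "j \<in> {1,2}" for i j
  proof -
    have "c 0 i 1 * X 1 j + c 0 i 2 * X 2 j =
      (c 0 i 1 * c 1 0 1 + c 0 i 2 * c 2 0 1) * c 1 j 0 + (c 0 i 1 * c 1 0 2 + c 0 i 2 * c 2 0 2) * c 2 j 0"
      by (simp add: X_def algebra_simps)
    hence "c 0 i 1 * X 1 j + c 0 i 2 * X 2 j = ?a * U i j"
      unfolding E(3)[OF that one(1)] E(3)[OF that one(2)] by (simp add: U_def algebra_simps)
    moreover have "c 0 i 1 * Y 1 j + c 0 i 2 * Y 2 j = c 0 j 1 * U i 1 + c 0 j 2 * U i 2"
      by (simp add: U_def Y_def algebra_simps)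
    moreover have "c 0 j 1 * U i 1 + c 0 j 2 * U i 2 = ?a * Y i j"
      unfolding UW(1)[OF that(1) one(1)] UW(1)[OF that(1) one(2)] by (simp add: Y_def algebra_simps)
    ultimately have "?a * Y i j = ?a * U i j"
      unfolding XY[OF one(1) that(2)] XY[OF one(2) that(2)] by simp
    thus ?thesis using a UW(1)[OF that] by simp
  qed
  have alt: "c i j 0 + c j i 0 = 0" if "i \<in> {1,2}" "j \<in> {1,2}" for i j
  proof -
    have "U i j + U j i + X i j = ?a * c i j 0"
      using E(8)[OF that one(1)] unfolding U_def X_def by simp
    hence "?a * (c i j 0 + c j i 0) = 0"
      unfolding UW(1)[OF that] UW(1)[OF that(2,1)] XY[OF that] Y[OF that] by (simp add: algebra_simps)
    thus ?thesis using a by simp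
  qed
  have d: "c 1 1 0 = 0" "c 2 2 0 = 0" using alt[OF one(1,1)] alt[OF one(2,2)] by simp_all
  have anti: "c 2 1 0 = - c 1 2 0" using alt[OF one(2,1)] by (simp add: eq_neg_iff_add_eq_0)
  have "c 1 2 0 = 0"
  proof (rule ccontr)
    assume b: "c 1 2 0 \<noteq> 0"
    have L: "c 0 1 1 = ?a" "c 1 0 1 = ?a"
      using UW(1)[OF one(1,2)] XY[OF one(1,2)] Y[OF one(1,2)] b d by (simp_all add: U_def X_def)
    have "3 * (?a * c 1 2 0) = 0"
      using E(9)[OF one(1,1,1) one(2)] by (simp add: d anti L algebra_simps)
    thus False using a b by simp
  qed
  thus ?thesis using ij d anti by auto
qed

text \<open>The matrix is \<open>a\<close> times an idempotent, of rank 0, 2 or 1; rank 1 means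
  trace \<open>a\<close> and determinant 0. The off-diagonal equations carry the factor
  \<open>x + t - a\<close>, which decides between the cases.\<close>

lemma idempotent_2x2_cases:
  fixes a :: complex
  assumes a: "a \<noteq> 0" and "x * x + y * z = a * x" "x * y + y * t = a * y" "z * x + t * z = a * z" "z * y + t * t = a * t"
  shows "x = 0 \<and> y = 0 \<and> z = 0 \<and> t = 0 \<or> x = a \<and> y = 0 \<and> z = 0 \<and> t = a \<or> x + t = a \<and> x * t = y * z"
proof (cases "x + t = a")
  case True
  have "x * t = y * z" using assms(2) unfolding True[symmetric] by (simp add: algebra_simps)
  thus ?thesis using True by simp
next
  case False
  have "y * (x + t - a) = 0" "z * (x + t - a) = 0" using assms by (simp_all add: algebra_simps)
  hence yz: "y = 0" "z = 0" using False by auto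
  hence "x * (x - a) = 0" "t * (t - a) = 0" using assms by (simp_all add: algebra_simps)
  hence "x = 0 \<or> x = a" "t = 0 \<or> t = a" by auto
  thus ?thesis using yz False by auto
qed

lemma rank_one_factor:
  fixes x :: complex
  assumes "x * t = y * z"
  obtains p q v w where "x = p * v" "y = p * w" "z = q * v" "t = q * w"
proof -
  consider "x \<noteq> 0" | "x = 0" "y \<noteq> 0" | "x = 0" "y = 0" by auto
  thus thesis
  proof cases
    case 1
    thus thesis using that[of 1 x y "z / x"] assms by (simp add: field_simps)
  next
    case 2
    thus thesis using that[of 1 0 y "t / y"] assms by auto
  next
    case 3
    thus thesis using that[of 0 z t 1] by simp
  qed
qed

text \<open>Left eigenvalues come before right ones: \<open>(a1, a2, b1, b2)\<close> stands for the
  multiset of the pairs \<open>(a1, b1)\<close> and \<open>(a2, b2)\<close>, one ordering per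
  multiset.\<close>

definition cone_types :: "(complex \<times> complex \<times> complex \<times> complex) set" where
  "cone_types = {(0,0,1,0), (1,0,1,1), (1,0,1,0), (0,0,0,0), (0,0,1,1), (1,1,1,1)}"

lemma classification_unital:
  assumes c: "c \<in> PermVar" and a: "c 0 0 0 \<noteq> 0"
  shows "\<exists>(a1, a2, b1, b2)\<in>cone_types. \<exists>x. c = cone a1 a2 b1 b2 x"
proof -
  let ?a = "c 0 0 0"
  have S: "c \<in> StructSpace" using c by (simp add: PermVar_def)
  have one: "(1::nat) \<in> {1,2}" "(2::nat) \<in> {1,2}" by auto
  note E = PermVar_eqs[OF c]
  note B = PermVar_unital_form_zero[OF c a]
  define l1 l2 l3 l4 where "l1 = c 0 1 1" and "l2 = c 0 1 2" and "l3 = c 0 2 1" and "l4 = c 0 2 2"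
  define m1 m2 m3 m4 where "m1 = c 1 0 1" and "m2 = c 1 0 2" and "m3 = c 2 0 1" and "m4 = c 2 0 2"
  note lm = l1_def[symmetric] l2_def[symmetric] l3_def[symmetric] l4_def[symmetric]
    m1_def[symmetric] m2_def[symmetric] m3_def[symmetric] m4_def[symmetric]
  have coneI: "\<exists>(a1, a2, b1, b2)\<in>cone_types. \<exists>x. c = cone a1 a2 b1 b2 x"
    if t: "(a1, a2, b1, b2) \<in> cone_types" and s: "p * v + q * w = ?a"
      and L: "l1 = (a1 - a2) * (p * v) + a2 * ?a" "l2 = (a1 - a2) * (p * w)"
        "l3 = (a1 - a2) * (q * v)" "l4 = (a1 - a2) * (q * w) + a2 * ?a"
      and M: "m1 = (b1 - b2) * (p * v) + b2 * ?a" "m2 = (b1 - b2) * (p * w)"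
        "m3 = (b1 - b2) * (q * v)" "m4 = (b1 - b2) * (q * w) + b2 * ?a"
    for a1 a2 b1 b2 p q v w
  proof -
    define x :: "nat \<Rightarrow> complex" where "x = (\<lambda>_. 0)(0 := v, 1 := w, 2 := p, 3 := q)"
    have x: "x 0 = v" "x 1 = w" "x 2 = p" "x 3 = q" by (simp_all add: x_def)
    have cs: "cone_s x = ?a" using s by (simp add: cone_s_def x algebra_simps)
    have "c = mk ?a (c 0) (\<lambda>i k. c i 0 k) (\<lambda>i j. c i j 0)" by (rule StructSpace_mk[OF S])
    also have "\<dots> = cone a1 a2 b1 b2 x"
      unfolding cone_def
      by (rule mk_eqI) (auto simp: cs cone_mat_def x lm L M B)
    finally show ?thesis using t by fast
  qed
  have LL: "l1 * l1 + l2 * l3 = ?a * l1" "l1 * l2 + l2 * l4 = ?a * l2"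
    "l3 * l1 + l4 * l3 = ?a * l3" "l3 * l2 + l4 * l4 = ?a * l4"
    using E(1)[OF one(1) one(1) one(1)] E(1)[OF one(1) one(1) one(2)]
      E(1)[OF one(2) one(1) one(1)] E(1)[OF one(2) one(1) one(2)] by (simp_all add: lm)
  have MM: "m1 * m1 + m2 * m3 = ?a * m1" "m1 * m2 + m2 * m4 = ?a * m2"
    "m3 * m1 + m4 * m3 = ?a * m3" "m3 * m2 + m4 * m4 = ?a * m4"
    using E(2)[OF one(1) one(1) one(1)] E(2)[OF one(1) one(1) one(2)]
      E(2)[OF one(2) one(1) one(1)] E(2)[OF one(2) one(1) one(2)] by (simp_all add: lm)
  have LM: "l1 * m1 + l2 * m3 = ?a * l1" "l1 * m2 + l2 * m4 = ?a * l2"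
    "l3 * m1 + l4 * m3 = ?a * l3" "l3 * m2 + l4 * m4 = ?a * l4"
    using E(3)[OF one(1) one(1) one(1)] E(3)[OF one(1) one(1) one(2)]
      E(3)[OF one(2) one(1) one(1)] E(3)[OF one(2) one(1) one(2)] by (simp_all add: lm)
  have RL: "m1 * l1 + m2 * l3 = ?a * l1" "m1 * l2 + m2 * l4 = ?a * l2"
    "m3 * l1 + m4 * l3 = ?a * l3" "m3 * l2 + m4 * l4 = ?a * l4"
    using E(4)[OF one(1) one(1) one(1)] E(4)[OF one(1) one(1) one(2)]
      E(4)[OF one(2) one(1) one(1)] E(4)[OF one(2) one(1) one(2)] by (simp_all add: lm)
  have Mcases: "m1 = 0 \<and> m2 = 0 \<and> m3 = 0 \<and> m4 = 0 \<or> m1 = ?a \<and> m2 = 0 \<and> m3 = 0 \<and> m4 = ?a \<or>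
      m1 + m4 = ?a \<and> m1 * m4 = m2 * m3"
    by (rule idempotent_2x2_cases[OF a MM])
  consider "l1 = 0" "l2 = 0" "l3 = 0" "l4 = 0" | "l1 = ?a" "l2 = 0" "l3 = 0" "l4 = ?a"
    | "l1 + l4 = ?a" "l1 * l4 = l2 * l3"
    using idempotent_2x2_cases[OF a LL] by blast
  thus ?thesis
  proof cases
    case 1
    from Mcases consider "m1 = 0" "m2 = 0" "m3 = 0" "m4 = 0" | "m1 = ?a" "m2 = 0" "m3 = 0" "m4 = ?a"
      | "m1 + m4 = ?a" "m1 * m4 = m2 * m3" by blast
    thus ?thesis
    proof cases
      case 1
      with \<open>l1 = 0\<close> \<open>l2 = 0\<close> \<open>l3 = 0\<close> \<open>l4 = 0\<close> show ?thesis
        \<comment> \<open>With \<open>L\<close> and \<open>M\<close> scalar the rank-one term has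
          coefficient 0, so any vector and functional pairing to \<open>?a\<close> will do.\<close>
        by (intro coneI[of 0 0 0 0 ?a 1 0 0]) (auto simp: cone_types_def)
    next
      case 2
      with \<open>l1 = 0\<close> \<open>l2 = 0\<close> \<open>l3 = 0\<close> \<open>l4 = 0\<close> show ?thesis
        by (intro coneI[of 0 0 1 1 ?a 1 0 0]) (auto simp: cone_types_def)
    next
      case 3
      obtain p q v w where f: "m1 = p * v" "m2 = p * w" "m3 = q * v" "m4 = q * w"
        using rank_one_factor[OF 3(2)] by metis
      show ?thesis
        by (rule coneI[of 0 0 1 0 p v q w])
          (use \<open>l1 = 0\<close> \<open>l2 = 0\<close> \<open>l3 = 0\<close> \<open>l4 = 0\<close> 3 f in \<open>auto simp: cone_types_def\<close>)
    qed
  next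
    case 2
    hence "m1 = ?a" "m2 = 0" "m3 = 0" "m4 = ?a" using LM a by simp_all
    with 2 show ?thesis by (intro coneI[of 1 1 1 1 ?a 1 0 0]) (auto simp: cone_types_def)
  next
    case 3
    obtain p q v w where f: "l1 = p * v" "l2 = p * w" "l3 = q * v" "l4 = q * w"
      using rank_one_factor[OF 3(2)] by metis
    from Mcases consider "m1 = 0" "m2 = 0" "m3 = 0" "m4 = 0" | "m1 = ?a" "m2 = 0" "m3 = 0" "m4 = ?a"
      | "m1 + m4 = ?a" "m1 * m4 = m2 * m3" by blast
    thus ?thesis
    proof cases
      case 1
      hence "l1 = 0" "l4 = 0" using LM a by simp_all
      thus ?thesis using 3 a by simp
    next
      case 2
      with 3 f show ?thesis
        by (intro coneI[of 1 0 1 1 p v q w]) (auto simp: cone_types_def)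
    next
      case M: 3
      txt \<open>\<open>M - L\<close> is \<open>a\<close> times an idempotent of trace zero.\<close>
      have "(m1 - l1) * (m1 - l1) + (m2 - l2) * (m3 - l3) = ?a * (m1 - l1)"
        "(m1 - l1) * (m2 - l2) + (m2 - l2) * (m4 - l4) = ?a * (m2 - l2)"
        "(m3 - l3) * (m1 - l1) + (m4 - l4) * (m3 - l3) = ?a * (m3 - l3)"
        "(m3 - l3) * (m2 - l2) + (m4 - l4) * (m4 - l4) = ?a * (m4 - l4)"
        using LL MM LM RL by (algebra, algebra, algebra, algebra)
      from idempotent_2x2_cases[OF a this] have "m1 - l1 = 0 \<and> m2 - l2 = 0 \<and> m3 - l3 = 0 \<and> m4 - l4 = 0"
      proof (elim disjE)
        assume "m1 - l1 = ?a \<and> m2 - l2 = 0 \<and> m3 - l3 = 0 \<and> m4 - l4 = ?a"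
        hence "2 * ?a = (m1 + m4) - (l1 + l4)" by (metis add_diff_add mult_2)
        thus ?thesis using 3 M a by simp
      next
        assume "m1 - l1 + (m4 - l4) = ?a \<and> (m1 - l1) * (m4 - l4) = (m2 - l2) * (m3 - l3)"
        hence "?a = (m1 + m4) - (l1 + l4)" by (metis add_diff_add)
        thus ?thesis using 3 M a by simp
      qed
      hence "m1 = l1" "m2 = l2" "m3 = l3" "m4 = l4" by simp_all
      with 3 f show ?thesis
        by (intro coneI[of 1 0 1 0 p v q w]) (auto simp: cone_types_def)
    qed
  qed
qed

text \<open>The normal form is \<open>\<nu>\<close> times the outer product of \<open>(p, q)\<close>
  and \<open>(- q, p)\<close>. Normalising \<open>(p, q)\<close> puts the whole scale into
  \<open>\<nu>\<close>, so no square root is needed.\<close>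

lemma square_zero_2x2:
  fixes x :: complex
  assumes "x * x + y * z = 0" "x * y + y * t = 0" "z * x + t * z = 0" "z * y + t * t = 0"
  obtains p q \<nu> where "p = 1 \<or> p = 0 \<and> q = 1" "x = - \<nu> * (p * q)" "y = \<nu> * (p * p)"
    "z = - \<nu> * (q * q)" "t = \<nu> * (q * p)"
proof -
  have t: "t = - x"
  proof (rule ccontr)
    assume "t \<noteq> - x"
    hence n: "x + t \<noteq> 0" by (simp add: eq_neg_iff_add_eq_0 add.commute)
    have "y * (x + t) = 0" "z * (x + t) = 0" using assms by (simp_all add: algebra_simps)
    hence "y = 0" "z = 0" using n by auto
    hence "x = 0" "t = 0" using assms by auto
    thus False using n by simp
  qed
  show thesis
  proof (cases "y = 0")
    case True
    hence "x = 0" using assms(1) by simp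
    thus thesis using that[of 0 1 "- z"] True t by simp
  next
    case False
    have "z = - (x * x) / y" using assms(1) False by (simp add: field_simps eq_neg_iff_add_eq_0)
    thus thesis using that[of 1 "- x / y" y] False t by (simp add: field_simps)
  qed
qed

text \<open>The equations say that the outer product \<open>N\<close> of \<open>(p, q)\<close> and
  \<open>(- q, p)\<close> annihilates the matrix on both sides. Image and kernel of \<open>N\<close>
  are the same line, so the matrix kills this line and maps into it, which leaves the multiples of
  \<open>N\<close>.\<close>

lemma nilpotent_annihilator_2x2:
  fixes x :: complex
  assumes pq: "p = 1 \<or> p = 0 \<and> q = 1"
    and "- x * (p * q) - y * (q * q) = 0" "x * (p * p) + y * (q * p) = 0"
      "- z * (p * q) - t * (q * q) = 0" "z * (p * p) + t * (q * p) = 0"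
      "- (p * q) * x + (p * p) * z = 0" "- (p * q) * y + (p * p) * t = 0"
      "- (q * q) * x + (q * p) * z = 0" "- (q * q) * y + (q * p) * t = 0"
  obtains \<mu> where "x = - \<mu> * (p * q)" "y = \<mu> * (p * p)" "z = - \<mu> * (q * q)" "t = \<mu> * (q * p)"
  using pq
proof
  assume p: "p = 1"
  have "x = - (y * q)" "t = q * y" "z = q * x" using assms(3,6,7) p
    by (simp_all add: eq_neg_iff_add_eq_0 algebra_simps)
  thus thesis using that[of y] p by simp
next
  assume p: "p = 0 \<and> q = 1"
  thus thesis using that[of "- z"] assms by simp
qed

lemma classification_nilpotent:
  assumes c: "c \<in> PermVar" and a: "c 0 0 0 = 0"
  shows "c \<in> range (forms 4) \<or> c \<in> range nilp"
proof -
  have S: "c \<in> StructSpace" using c by (simp add: PermVar_def)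
  have one: "(1::nat) \<in> {1,2}" "(2::nat) \<in> {1,2}" by auto
  note E = PermVar_eqs[OF c, unfolded a mult_zero_left diff_0_right]
  note mk = StructSpace_mk[OF S, unfolded a]
  define l1 l2 l3 l4 where "l1 = c 0 1 1" and "l2 = c 0 1 2" and "l3 = c 0 2 1" and "l4 = c 0 2 2"
  define m1 m2 m3 m4 where "m1 = c 1 0 1" and "m2 = c 1 0 2" and "m3 = c 2 0 1" and "m4 = c 2 0 2"
  define b1 b2 b3 b4 where "b1 = c 1 1 0" and "b2 = c 1 2 0" and "b3 = c 2 1 0" and "b4 = c 2 2 0"
  note lm = l1_def[symmetric] l2_def[symmetric] l3_def[symmetric] l4_def[symmetric]
    m1_def[symmetric] m2_def[symmetric] m3_def[symmetric] m4_def[symmetric]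
    b1_def[symmetric] b2_def[symmetric] b3_def[symmetric] b4_def[symmetric]
  have LL: "l1 * l1 + l2 * l3 = 0" "l1 * l2 + l2 * l4 = 0" "l3 * l1 + l4 * l3 = 0" "l3 * l2 + l4 * l4 = 0"
    using E(1)[OF one(1) one(1) one(1)] E(1)[OF one(1) one(1) one(2)]
      E(1)[OF one(2) one(1) one(1)] E(1)[OF one(2) one(1) one(2)] by (simp_all only: lm)
  have MM: "m1 * m1 + m2 * m3 = 0" "m1 * m2 + m2 * m4 = 0" "m3 * m1 + m4 * m3 = 0" "m3 * m2 + m4 * m4 = 0"
    using E(2)[OF one(1) one(1) one(1)] E(2)[OF one(1) one(1) one(2)]
      E(2)[OF one(2) one(1) one(1)] E(2)[OF one(2) one(1) one(2)] by (simp_all only: lm)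
  have LM: "l1 * m1 + l2 * m3 = 0" "l1 * m2 + l2 * m4 = 0" "l3 * m1 + l4 * m3 = 0" "l3 * m2 + l4 * m4 = 0"
    using E(3)[OF one(1) one(1) one(1)] E(3)[OF one(1) one(1) one(2)]
      E(3)[OF one(2) one(1) one(1)] E(3)[OF one(2) one(1) one(2)] by (simp_all only: lm)
  have RL: "m1 * l1 + m2 * l3 = 0" "m1 * l2 + m2 * l4 = 0" "m3 * l1 + m4 * l3 = 0" "m3 * l2 + m4 * l4 = 0"
    using E(4)[OF one(1) one(1) one(1)] E(4)[OF one(1) one(1) one(2)]
      E(4)[OF one(2) one(1) one(1)] E(4)[OF one(2) one(1) one(2)] by (simp_all only: lm)
  show ?thesis
  proof (cases "l1 = 0 \<and> l2 = 0 \<and> l3 = 0 \<and> l4 = 0 \<and> m1 = 0 \<and> m2 = 0 \<and> m3 = 0 \<and> m4 = 0")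
    case True
    have "c = forms 4 ((\<lambda>_. 0)(0 := b1, 1 := b2, 2 := b3, 3 := b4))"
      by (subst mk, unfold forms_def, rule mk_eqI) (use True in \<open>auto simp: lm form_idx_def\<close>)
    thus ?thesis by blast
  next
    case nz: False
    obtain p q \<kappa> \<mu> where pq: "p = 1 \<or> p = 0 \<and> q = 1"
      and l: "l1 = - \<kappa> * (p * q)" "l2 = \<kappa> * (p * p)" "l3 = - \<kappa> * (q * q)" "l4 = \<kappa> * (q * p)"
      and m: "m1 = - \<mu> * (p * q)" "m2 = \<mu> * (p * p)" "m3 = - \<mu> * (q * q)" "m4 = \<mu> * (q * p)"
    proof (cases "l1 = 0 \<and> l2 = 0 \<and> l3 = 0 \<and> l4 = 0")
      case True
      obtain p q \<mu> where "p = 1 \<or> p = 0 \<and> q = 1" "m1 = - \<mu> * (p * q)" "m2 = \<mu> * (p * p)"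
        "m3 = - \<mu> * (q * q)" "m4 = \<mu> * (q * p)"
        by (rule square_zero_2x2[OF MM])
      thus thesis using that[of p q 0 \<mu>] True by simp
    next
      case False
      obtain p q \<kappa> where pq: "p = 1 \<or> p = 0 \<and> q = 1"
        and l: "l1 = - \<kappa> * (p * q)" "l2 = \<kappa> * (p * p)" "l3 = - \<kappa> * (q * q)" "l4 = \<kappa> * (q * p)"
        by (rule square_zero_2x2[OF LL])
      have "\<kappa> \<noteq> 0" using False l by auto
      have cancel: "u = 0" if "\<kappa> * u = 0" for u using that \<open>\<kappa> \<noteq> 0\<close> by simp
      obtain \<mu> where "m1 = - \<mu> * (p * q)" "m2 = \<mu> * (p * p)" "m3 = - \<mu> * (q * q)" "m4 = \<mu> * (q * p)"
        by (rule nilpotent_annihilator_2x2[OF pq, of m1 m2 m3 m4])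
          (rule cancel, use LM RL in \<open>simp add: l algebra_simps\<close>)+
      thus thesis using that pq l by blast
    qed
    have \<kappa>\<mu>: "\<kappa> \<noteq> 0 \<or> \<mu> \<noteq> 0" using nz l m by auto
    \<comment> \<open>To be applied with \<open>u = B(n, g)\<close> and \<open>w = B(g, n)\<close>,
      where \<open>n\<close> spans the kernel of the form \<open>(p, q)\<close> and the form is 1 at
      \<open>g\<close>. If \<open>u\<close> is nonzero, \<open>\<mu> = - 2 \<kappa>\<close> and
      \<open>w = 2 u\<close>, and the first relation reads
      \<open>4 \<kappa> u = \<kappa> u\<close>.\<close>
    have no: "u = 0 \<and> w = 0"
      if A: "- (\<mu> * w) = \<kappa> * u" and B: "(\<kappa> + \<mu>) * u = \<kappa> * w" and C: "(2 * \<kappa> + \<mu>) * u = 0"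
        and D: "\<kappa> * (2 * u - w) = 0" for u w
    proof -
      have u: "u = 0"
      proof (rule ccontr)
        assume u: "u \<noteq> 0"
        hence \<mu>: "\<mu> = - (2 * \<kappa>)" using C by (simp add: eq_neg_iff_add_eq_0 add.commute)
        hence "\<kappa> \<noteq> 0" using \<kappa>\<mu> by auto
        hence "w = 2 * u" using D by simp
        hence "3 * (\<kappa> * u) = 0" using A \<mu> by (simp add: algebra_simps)
        thus False using u \<open>\<kappa> \<noteq> 0\<close> by simp
      qed
      thus ?thesis using A B \<kappa>\<mu> by auto
    qed
    have zero: "u = 0" if "\<kappa> * u = 0" "\<mu> * u = 0" for u using that \<kappa>\<mu> by auto
    obtain b where b: "b1 = b * (p * p)" "b2 = b * (p * q)" "b3 = b * (q * p)" "b4 = b * (q * q)"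
      using pq
    proof
      assume p: "p = 1"
      \<comment> \<open>With \<open>n = f_2 - q f_1\<close> in the kernel, these are
        \<open>B(n, f_1)\<close>, \<open>B(n, f_2)\<close>, \<open>B(f_1, n)\<close>,
        \<open>B(f_2, n)\<close>; all must vanish for \<open>B\<close> to be a multiple of the
        square of the form.\<close>
      define u1 u2 w1 w2 where "u1 = b3 - q * b1" and "u2 = b4 - q * b2" and "w1 = b2 - q * b1" and "w2 = b4 - q * b3"
      note uw = u1_def u2_def w1_def w2_def
      have e: "\<kappa> * u2 = \<kappa> * q * u1" "- \<mu> * w1 = \<kappa> * u1" "- \<mu> * w2 = \<kappa> * q * u1" 
        "\<mu> * u1 - \<kappa> * w1 = - \<kappa> * u1" "2 * \<kappa> * u1 + \<mu> * u1 = 0" "\<kappa> * (2 * u1 - w1) = 0"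
        using E(5)[OF one(1) one(2) one(1)] E(6)[OF one(1) one(1) one(1)] E(6)[OF one(2) one(1) one(1)]
          E(7)[OF one(1) one(1) one(1)] E(8)[OF one(1) one(1) one(1)] E(10)[OF one(1) one(1) one(2) one(2)]
        unfolding uw by (simp_all add: lm l m p algebra_simps)
      have "u1 = 0 \<and> w1 = 0" by (rule no) (use e in \<open>simp_all add: algebra_simps\<close>)
      moreover from this have "\<kappa> * u2 = 0" "\<mu> * w2 = 0" using e by auto
      ultimately have "b3 = q * b1" "b2 = q * b1" "b4 = q * q * b1"
        using zero[of "b4 - q * q * b1"] by (simp_all add: uw algebra_simps)
      thus thesis using that[of b1] p by (simp add: algebra_simps)
    next
      assume p: "p = 0 \<and> q = 1"
      \<comment> \<open>Here the kernel is spanned by \<open>f_1\<close>, so everything except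
        \<open>b4\<close> has to vanish.\<close>
      have e: "\<kappa> * b1 = 0" "\<mu> * b1 = 0" "- \<mu> * b3 = \<kappa> * b2" "(\<kappa> + \<mu>) * b2 = \<kappa> * b3"
        "\<kappa> * (b2 * 2) = - (\<mu> * b2)" "\<kappa> * (2 * b2 - b3) = 0"
        using E(5)[OF one(1) one(2) one(1)] E(6)[OF one(1) one(2) one(1)] E(6)[OF one(2) one(2) one(1)]
          E(7)[OF one(2) one(2) one(1)] E(8)[OF one(2) one(2) one(1)] E(10)[OF one(2) one(2) one(1) one(1)]
        by (simp_all add: lm l m p algebra_simps)
      have "(2 * \<kappa> + \<mu>) * b2 = \<kappa> * (b2 * 2) + \<mu> * b2" by (simp add: algebra_simps)
      hence C: "(2 * \<kappa> + \<mu>) * b2 = 0" unfolding e(5) by simp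
      have "b2 = 0 \<and> b3 = 0" by (rule no[OF _ e(4) C e(6)]) (use e(3) in simp)
      moreover have "b1 = 0" by (rule zero) (use e in simp_all)
      ultimately show thesis using that[of b4] p by simp
    qed
    have "c = nilp ((\<lambda>_. 0)(0 := \<kappa>, 1 := \<mu>, 2 := b, 3 := q, 4 := p))"
      by (subst mk, unfold nilp_def nilp_mat_def, rule mk_eqI) (auto simp: lm l m b algebra_simps)
    thus ?thesis by blast
  qed
qed

section \<open>The irreducible components\<close>

definition cn :: "complex \<times> complex \<times> complex \<times> complex \<Rightarrow> (nat \<Rightarrow> complex) \<Rightarrow> sstruct" where
  "cn t = (case t of (a1, a2, b1, b2) \<Rightarrow> cone a1 a2 b1 b2)"

definition un :: "complex \<times> complex \<times> complex \<times> complex \<Rightarrow> sstruct" where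
  "un t = (case t of (a1, a2, b1, b2) \<Rightarrow> unital a1 a2 b1 b2)"

text \<open>The linear form \<open>3 tr L + tr M\<close> is \<open>wt t\<close> times \<open>a\<close> on the cone of type \<open>t\<close>;
  the factor 3 makes the six weights distinct.\<close>

definition wt :: "complex \<times> complex \<times> complex \<times> complex \<Rightarrow> complex" where
  "wt t = (case t of (a1, a2, b1, b2) \<Rightarrow> 3 * (a1 + a2) + (b1 + b2))"

definition ell :: "sstruct \<Rightarrow> complex" where
  "ell c = 3 * (c 0 1 1 + c 0 2 2) + (c 1 0 1 + c 2 0 2)"

lemma inj_wt: "inj_on wt cone_types"
  by (auto simp: inj_on_def cone_types_def wt_def)

lemma finite_cone_types: "finite cone_types"
  by (simp add: cone_types_def)

lemma card_cone_types: "card cone_types = 6"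
  by (simp add: cone_types_def)

lemma polyfun_ell: "ell \<in> polyfun"
  unfolding ell_def[abs_def] by (intro pf_intros)

lemma cn_0: "cn t x 0 0 0 = cone_s x"
  by (simp add: cn_def cone_def mk_simps split: prod.split)

lemma ell_cn: "ell (cn t x) = wt t * cone_s x"
  by (simp add: cn_def cone_def mk_simps ell_def wt_def cone_mat_def cone_s_def algebra_simps split: prod.split)

lemma cn_form: "cn t x 1 1 0 = 0"
  by (simp add: cn_def cone_def mk_simps split: prod.split)

lemma polymap_cn: "polymap (cn t)"
  by (simp add: cn_def polymap_cone split: prod.split)

lemma orbit_un: "orbit (un t) = cn t ` {x. cone_s x \<noteq> 0}"
  by (simp add: cn_def un_def orbit_unital split: prod.split)

lemma un_StructSpace: "un t \<in> StructSpace"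
  by (simp add: un_def unital_def mk_StructSpace split: prod.split)

lemma cn_in_PermVar: "t \<in> cone_types \<Longrightarrow> cn t x \<in> PermVar"
  by (auto simp: cn_def cone_types_def intro!: cone_in_PermVar)

lemma cone_s_mpf: "cone_s \<in> mpf"
  unfolding cone_s_def[abs_def] by (intro mpf_intros)

lemma zclosure_orbit_un: "zclosure (orbit (un t)) = zclosure (range (cn t))"
  by (rule zclosure_dense[OF polymap_cn cone_s_mpf, of "\<lambda>_. 1"]) (auto simp: orbit_un cone_s_def)

lemma zclosure_orbits_R04: "zclosure (\<Union>\<alpha>. orbit (R04 \<alpha>)) = zclosure (range (forms 4))"
proof (rule zclosure_dense[OF polymap_forms])
  show "forms_generic \<in> mpf" unfolding forms_generic_def[abs_def] by (intro mpf_intros)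
  show "forms_generic ((\<lambda>_. 0)(0 := 1, 1 := 1)) \<noteq> 0" by (simp add: forms_generic_def)
  show "forms 4 ` {x. forms_generic x \<noteq> 0} \<subseteq> (\<Union>\<alpha>. orbit (R04 \<alpha>))"
    using forms_generic_orbit by (auto simp: image_subset_iff)
  show "(\<Union>\<alpha>. orbit (R04 \<alpha>)) \<subseteq> range (forms 4)"
    by (rule UN_least) (rule orbit_R04_subset)
qed

lemma zclosure_orbits_R07: "zclosure (\<Union>\<alpha>. orbit (R07 \<alpha>)) = zclosure (range nilp)"
proof (rule zclosure_dense[OF polymap_nilp])
  show "nilp_generic \<in> mpf" unfolding nilp_generic_def[abs_def] by (intro mpf_intros)
  show "nilp_generic (\<lambda>_. 1) \<noteq> 0" by (simp add: nilp_generic_def)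
  show "nilp ` {x. nilp_generic x \<noteq> 0} \<subseteq> (\<Union>\<alpha>. orbit (R07 \<alpha>))"
    using nilp_generic_orbit by (auto simp: image_subset_iff)
  show "(\<Union>\<alpha>. orbit (R07 \<alpha>)) \<subseteq> range (nilp)"
    by (rule UN_least) (rule orbit_R07_subset)
qed

definition comps :: "sstruct set set" where
  "comps = insert (zclosure (range (forms 4))) (insert (zclosure (range nilp))
    ((\<lambda>t. zclosure (range (cn t))) ` cone_types))"

lemma classification:
  assumes "c \<in> PermVar"
  shows "c 0 0 0 \<noteq> 0 \<and> (\<exists>t\<in>cone_types. c \<in> range (cn t)) \<or>
    c 0 0 0 = 0 \<and> (c \<in> range (forms 4) \<or> c \<in> range nilp)"
proof (cases "c 0 0 0 = 0")
  case True
  thus ?thesis using classification_nilpotent[OF assms] by blast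
next
  case False
  obtain a1 a2 b1 b2 x where "(a1, a2, b1, b2) \<in> cone_types" "c = cone a1 a2 b1 b2 x"
    using classification_unital[OF assms False] by auto
  hence "c = cn (a1, a2, b1, b2) x" by (simp add: cn_def)
  thus ?thesis using False \<open>(a1, a2, b1, b2) \<in> cone_types\<close> by blast
qed

lemma mem_zclosure_range: "g x \<in> zclosure (range g)"
  by (rule subsetD[OF zclosure_superset]) (rule rangeI)

lemma Union_comps: "\<Union>comps = PermVar"
proof
  have "zclosure (range (forms 4)) \<subseteq> PermVar" "zclosure (range nilp) \<subseteq> PermVar"
    using forms_in_PermVar nilp_in_PermVar by (auto intro!: zclosure_least[OF zclosed_PermVar])
  moreover have "zclosure (range (cn t)) \<subseteq> PermVar" if "t \<in> cone_types" for t
    using cn_in_PermVar[OF that] by (auto intro!: zclosure_least[OF zclosed_PermVar])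
  ultimately show "\<Union>comps \<subseteq> PermVar" unfolding comps_def by blast
  show "PermVar \<subseteq> \<Union>comps"
  proof
    fix c assume "c \<in> PermVar"
    from classification[OF this]
    have "(\<exists>t\<in>cone_types. c \<in> zclosure (range (cn t))) \<or> c \<in> zclosure (range (forms 4)) \<or>
      c \<in> zclosure (range nilp)"
      by (auto intro: mem_zclosure_range)
    thus "c \<in> \<Union>comps" unfolding comps_def by auto
  qed
qed

lemma zirreducible_comps: "X \<in> comps \<Longrightarrow> zirreducible X"
  unfolding comps_def
  by (auto intro: zirreducible_polymap polymap_forms polymap_nilp polymap_cn)

lemma zclosure_range_vanish:
  assumes "polymap g" "p \<in> polyfun" "\<And>x. p (g x) = 0" "c \<in> zclosure (range g)"
  shows "p c = 0"
  by (rule zclosure_vanish[OF assms(2) range_polymap[OF assms(1)] _ assms(4)]) (use assms(3) in auto)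

text \<open>Equations valid along a parametrisation persist on the closure; together with those in
  \<open>forms_closure\<close> and \<open>nilp_closure\<close> they separate all eight
  components.\<close>

lemma cn_closure:
  assumes "c \<in> zclosure (range (cn t))"
  shows "ell c = wt t * c 0 0 0" "c 1 1 0 = 0"
proof -
  have "(\<lambda>c. ell c - wt t * c 0 0 0) \<in> polyfun"
    using polyfun_ell by (intro pf_diff pf_mult pf_const pf_coord)
  from zclosure_range_vanish[OF polymap_cn this _ assms] show "ell c = wt t * c 0 0 0"
    by (simp add: cn_0 ell_cn)
  show "c 1 1 0 = 0"
    by (rule zclosure_range_vanish[OF polymap_cn pf_coord cn_form assms])
qed

lemma forms_closure:
  assumes "c \<in> zclosure (range (forms 4))"
  shows "c 0 0 0 = 0" "c 0 1 2 = 0"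
  by (rule zclosure_range_vanish[OF polymap_forms pf_coord _ assms], simp add: forms_def mk_simps)+

lemma nilp_closure:
  assumes "c \<in> zclosure (range nilp)"
  shows "c 0 0 0 = 0" "c 1 1 0 * c 2 2 0 = c 1 2 0 * c 2 1 0"
proof -
  show "c 0 0 0 = 0"
    by (rule zclosure_range_vanish[OF polymap_nilp pf_coord _ assms]) (simp add: nilp_def mk_simps)
  have "c 1 1 0 * c 2 2 0 - c 1 2 0 * c 2 1 0 = 0"
    by (rule zclosure_range_vanish[OF polymap_nilp _ _ assms], intro pf_intros)
      (simp add: nilp_def mk_simps)
  thus "c 1 1 0 * c 2 2 0 = c 1 2 0 * c 2 1 0" by simp
qed

lemma un_mem: "un t \<in> zclosure (range (cn t))"
  unfolding zclosure_orbit_un[symmetric]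
  by (rule subsetD[OF zclosure_superset orbit_refl[OF un_StructSpace]])

lemma un_0: "un t 0 0 0 = 1"
  by (simp add: un_def unital_def mk_simps split: prod.split)

lemma cn_not_subset:
  "\<not> zclosure (range (cn t)) \<subseteq> zclosure (range (forms 4))"
  "\<not> zclosure (range (cn t)) \<subseteq> zclosure (range nilp)"
  by (metis un_mem un_0 forms_closure(1) subsetD zero_neq_one)
    (metis un_mem un_0 nilp_closure(1) subsetD zero_neq_one)

lemma cn_subset_imp_eq:
  assumes "t \<in> cone_types" "t' \<in> cone_types" "zclosure (range (cn t)) \<subseteq> zclosure (range (cn t'))"
  shows "t = t'"
proof -
  have "un t \<in> zclosure (range (cn t'))" using un_mem assms(3) by blast
  hence "wt t = wt t'" using cn_closure(1)[OF un_mem] cn_closure(1) by (metis mult_cancel_right un_0 zero_neq_one)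
  thus ?thesis using inj_wt assms(1,2) by (auto dest: inj_onD)
qed

lemma forms_not_subset:
  "\<not> zclosure (range (forms 4)) \<subseteq> zclosure (range (cn t))"
  "\<not> zclosure (range (forms 4)) \<subseteq> zclosure (range nilp)"
proof -
  \<comment> \<open>A nondegenerate form with \<open>c 1 1 0\<close> nonzero: the determinant
    separates it from \<open>nilp\<close>, the entry from the cones.\<close>
  define c where "c = forms 4 ((\<lambda>_. 0)(0 := 1, 3 := 1))"
  have c: "c \<in> zclosure (range (forms 4))" unfolding c_def by (rule mem_zclosure_range)
  have e: "c 1 1 0 = 1" "c 2 2 0 = 1" "c 1 2 0 = 0" by (simp_all add: c_def forms_def mk_simps form_idx_def)
  show "\<not> zclosure (range (forms 4)) \<subseteq> zclosure (range (cn t))"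
  proof
    assume "zclosure (range (forms 4)) \<subseteq> zclosure (range (cn t))"
    with c have "c \<in> zclosure (range (cn t))" by (rule rev_subsetD)
    from cn_closure(2)[OF this] show False by (simp add: e)
  qed
  show "\<not> zclosure (range (forms 4)) \<subseteq> zclosure (range nilp)"
  proof
    assume "zclosure (range (forms 4)) \<subseteq> zclosure (range nilp)"
    with c have "c \<in> zclosure (range nilp)" by (rule rev_subsetD)
    from nilp_closure(2)[OF this] show False by (simp add: e)
  qed
qed

lemma nilp_not_subset:
  "\<not> zclosure (range nilp) \<subseteq> zclosure (range (cn t))"
  "\<not> zclosure (range nilp) \<subseteq> zclosure (range (forms 4))"
proof -
  define c where "c = nilp (\<lambda>_. 1)"
  have c: "c \<in> zclosure (range nilp)" unfolding c_def by (rule mem_zclosure_range)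
  have e: "c 1 1 0 = 1" "c 0 1 2 = 1" by (simp_all add: c_def nilp_def nilp_mat_def mk_simps)
  show "\<not> zclosure (range nilp) \<subseteq> zclosure (range (cn t))"
  proof
    assume "zclosure (range nilp) \<subseteq> zclosure (range (cn t))"
    with c have "c \<in> zclosure (range (cn t))" by (rule rev_subsetD)
    from cn_closure(2)[OF this] show False by (simp add: e)
  qed
  show "\<not> zclosure (range nilp) \<subseteq> zclosure (range (forms 4))"
  proof
    assume "zclosure (range nilp) \<subseteq> zclosure (range (forms 4))"
    with c have "c \<in> zclosure (range (forms 4))" by (rule rev_subsetD)
    from forms_closure(2)[OF this] show False by (simp add: e)
  qed
qed

lemma irr_components_PermVar: "irr_components PermVar = comps"
proof (rule irr_components_eq[OF _ Union_comps zirreducible_comps])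
  show "finite comps" by (simp add: comps_def finite_cone_types)
  fix X Y assume XY: "X \<in> comps" "Y \<in> comps" "X \<subseteq> Y"
  show "X = Y"
    using XY(1,2) unfolding comps_def
    by (elim insertE imageE)
      (use XY(3) cn_not_subset forms_not_subset nilp_not_subset cn_subset_imp_eq in blast)+
qed

lemma card_comps: "card comps = 8"
proof -
  have "inj_on (\<lambda>t. zclosure (range (cn t))) cone_types"
    by (rule inj_onI) (use cn_subset_imp_eq in auto)
  hence c: "card ((\<lambda>t. zclosure (range (cn t))) ` cone_types) = 6"
    by (simp add: card_image card_cone_types)
  have ne: "zclosure (range nilp) \<noteq> zclosure (range (cn t))" "zclosure (range (forms 4)) \<noteq> zclosure (range (cn t))"
    "zclosure (range (forms 4)) \<noteq> zclosure (range nilp)" for t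
    using nilp_not_subset(1)[of t] forms_not_subset(1)[of t] forms_not_subset(2) by (metis order_refl)+
  have "zclosure (range nilp) \<notin> (\<lambda>t. zclosure (range (cn t))) ` cone_types"
    "zclosure (range (forms 4)) \<notin> insert (zclosure (range nilp)) ((\<lambda>t. zclosure (range (cn t))) ` cone_types)"
    using ne by blast+
  thus ?thesis
    using c finite_cone_types unfolding comps_def by simp
qed

section \<open>Rigid structures\<close>

lemma pf_prod: "(\<And>i. i \<in> I \<Longrightarrow> p i \<in> polyfun) \<Longrightarrow> (\<lambda>x. \<Prod>i\<in>I. p i x) \<in> polyfun"
  by (induction I rule: infinite_finite_induct) (auto intro: pf_const pf_mult)

lemma mem_orbit_un_iff:
  assumes "t \<in> cone_types" "c \<in> PermVar"
  shows "c \<in> orbit (un t) \<longleftrightarrow> c 0 0 0 \<noteq> 0 \<and> ell c = wt t * c 0 0 0"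
proof
  assume "c \<in> orbit (un t)"
  thus "c 0 0 0 \<noteq> 0 \<and> ell c = wt t * c 0 0 0" by (auto simp: orbit_un cn_0 ell_cn)
next
  assume R: "c 0 0 0 \<noteq> 0 \<and> ell c = wt t * c 0 0 0"
  then obtain t' x where t': "t' \<in> cone_types" "c = cn t' x"
    using classification[OF assms(2)] by blast
  hence "cone_s x \<noteq> 0" "wt t' = wt t" using R by (auto simp: cn_0 ell_cn)
  hence "t' = t" using inj_wt assms(1) t'(1) by (auto dest: inj_onD)
  thus "c \<in> orbit (un t)" using t' \<open>cone_s x \<noteq> 0\<close> by (auto simp: orbit_un)
qed

lemma mem_orbit_un:
  assumes "c \<in> PermVar" "c 0 0 0 \<noteq> 0"
  obtains t where "t \<in> cone_types" "c \<in> orbit (un t)"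
proof -
  obtain t x where t: "t \<in> cone_types" "c = cn t x" using classification[OF assms(1)] assms(2) by blast
  thus thesis using that[of t] assms(2) by (auto simp: orbit_un cn_0)
qed

lemma orbit_un_subset: "t \<in> cone_types \<Longrightarrow> orbit (un t) \<subseteq> PermVar"
  by (simp add: orbit_un image_subset_iff cn_in_PermVar)

lemma rigid_un:
  assumes t: "t \<in> cone_types"
  shows "rigid_in PermVar (un t)"
proof -
  \<comment> \<open>The first factor vanishes where \<open>a = 0\<close>, the others on the five
    remaining orbits, so the zero set in \<open>PermVar\<close> is exactly the complement of the
    orbit.\<close>
  let ?p = "\<lambda>c. c 0 0 0 * (\<Prod>t'\<in>cone_types - {t}. ell c - wt t' * c 0 0 0)"
  have "PermVar - orbit (un t) = {c \<in> PermVar. ?p c = 0}"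
  proof (intro set_eqI iffI)
    fix c assume c: "c \<in> PermVar - orbit (un t)"
    show "c \<in> {c \<in> PermVar. ?p c = 0}"
    proof (cases "c 0 0 0 = 0")
      case False
      then obtain t' where t': "t' \<in> cone_types" "c \<in> orbit (un t')" using c mem_orbit_un by blast
      hence "ell c = wt t' * c 0 0 0" "t' \<noteq> t" using c mem_orbit_un_iff by blast+
      hence "(\<Prod>t'\<in>cone_types - {t}. ell c - wt t' * c 0 0 0) = 0"
        using t'(1) finite_cone_types by (intro prod_zero) auto
      thus ?thesis using c by simp
    qed (use c in auto)
  next
    fix c assume c: "c \<in> {c \<in> PermVar. ?p c = 0}"
    have "c \<notin> orbit (un t)"
    proof
      assume "c \<in> orbit (un t)"
      hence e: "c 0 0 0 \<noteq> 0" "ell c = wt t * c 0 0 0" using mem_orbit_un_iff[OF t] c by blast+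
      moreover have "ell c - wt t' * c 0 0 0 \<noteq> 0" if "t' \<in> cone_types - {t}" for t'
        using that e inj_wt t by (auto dest: inj_onD)
      ultimately have "?p c \<noteq> 0" using finite_cone_types by simp
      thus False using c by blast
    qed
    thus "c \<in> PermVar - orbit (un t)" using c by blast
  qed
  moreover have "?p \<in> polyfun"
    using polyfun_ell by (intro pf_mult pf_prod pf_diff pf_const pf_coord)
  ultimately have "zclosed (PermVar - orbit (un t))"
    using zclosed_hypersurface[OF zclosed_PermVar, of ?p] by (simp only:)
  thus ?thesis
    using subsetD[OF orbit_un_subset[OF t] orbit_refl[OF un_StructSpace]] by (simp add: rigid_in_def)
qed

text \<open>An open orbit would meet the irreducible set \<open>X\<close> in a dense subset, so a
  polynomial vanishing on the orbit would vanish on all of \<open>X\<close>.\<close>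

lemma not_rigid_if_invariant:
  assumes "zirreducible X" "X \<subseteq> V" "c \<in> X" "p \<in> polyfun" "\<And>d. d \<in> orbit c \<Longrightarrow> p d = 0"
    "d \<in> X" "p d \<noteq> 0"
  shows "\<not> rigid_in V c"
proof
  assume "rigid_in V c"
  hence cl: "zclosed (V - orbit c)" by (simp add: rigid_in_def)
  have XS: "X \<subseteq> StructSpace" using assms(1) zclosed_subset by (auto simp: zirreducible_def)
  have "X \<subseteq> (V - orbit c) \<union> {d \<in> StructSpace. p d = 0}"
    using assms(2,5) XS by blast
  hence "X \<subseteq> V - orbit c \<or> X \<subseteq> {d \<in> StructSpace. p d = 0}"
    using assms(1) cl zclosed_hypersurface[OF zclosed_StructSpace assms(4)]
    unfolding zirreducible_def by blast
  moreover have "c \<in> orbit c" using assms(3) XS by (intro orbit_refl) auto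
  ultimately show False using assms(3,6,7) by blast
qed

lemma comps_subset: "X \<in> comps \<Longrightarrow> X \<subseteq> PermVar"
  using Union_comps by blast

text \<open>The ratio of the discriminant to the square of the alternating part is an invariant of a form.\<close>

lemma not_rigid_forms: "\<not> rigid_in PermVar (forms 4 x)"
proof -
  define c where "c = forms 4 x"
  define P where "P d = d 1 2 0 - d 2 1 0" for d :: sstruct
  define Q where "Q d = 4 * (d 1 1 0 * d 2 2 0) - (d 1 2 0 + d 2 1 0) ^ 2" for d :: sstruct
  have PQ: "P \<in> polyfun" "Q \<in> polyfun"
    unfolding P_def[abs_def] Q_def[abs_def] by (intro pf_intros)+
  have orb: "\<exists>r. P d = r * P c \<and> Q d = r ^ 2 * Q c" if d: "d \<in> orbit c" for d
  proof -
    obtain G H where GH: "gl_pair G H" "d = act G H c" using d by (auto simp: orbit_def)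
    define B where "B i j = (if form_idx i j < 4 then x (form_idx i j) else 0)" for i j
    have cB: "c = mk 0 (\<lambda>_ _. 0) (\<lambda>_ _. 0) B" unfolding c_def forms_def B_def ..
    \<comment> \<open>The alternating part scales by \<open>r\<close>, the discriminant by its
      square.\<close>
    define r where "r = G 0 0 * (H 1 1 * H 2 2 - H 1 2 * H 2 1)"
    have "P d = r * P c" unfolding GH(2) cB act_mk[OF GH(1)]
      by (simp add: P_def mk_simps r_def algebra_simps)
    moreover have "Q d = r ^ 2 * Q c" unfolding GH(2) cB act_mk[OF GH(1)]
      by (simp add: Q_def mk_simps r_def algebra_simps power2_eq_square)
    ultimately show ?thesis by blast
  qed
  have irr: "zirreducible (zclosure (range (forms 4)))" "zclosure (range (forms 4)) \<subseteq> PermVar"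
    by (rule zirreducible_comps comps_subset, simp add: comps_def)+
  have mem: "forms 4 y \<in> zclosure (range (forms 4))" for y by (rule mem_zclosure_range)
  show ?thesis
  proof (cases "P c = 0")
    case True
    have "P (forms 4 ((\<lambda>_. 0)(1 := 1))) \<noteq> 0" by (simp add: P_def forms_def mk_simps form_idx_def)
    thus ?thesis
      using not_rigid_if_invariant[OF irr mem PQ(1) _ mem] orb True unfolding c_def by fastforce
  next
    case False
    \<comment> \<open>A symmetric nondegenerate form: it violates the equation
      \<open>Q d / P d ^ 2 = Q c / P c ^ 2\<close> once denominators are cleared.\<close>
    let ?d = "forms 4 ((\<lambda>_. 0)(0 := 1, 3 := 1))"
    have "(\<lambda>d. Q d * P c ^ 2 - Q c * P d ^ 2) \<in> polyfun" using PQ by (intro pf_intros)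
    moreover have "Q d * P c ^ 2 - Q c * P d ^ 2 = 0" if "d \<in> orbit c" for d
      using orb[OF that] by (auto simp: power_mult_distrib)
    moreover have "P ?d = 0" "Q ?d = 4"
      by (simp_all add: P_def Q_def forms_def mk_simps form_idx_def)
    hence "Q ?d * P c ^ 2 - Q c * P ?d ^ 2 \<noteq> 0" using False by simp
    ultimately show ?thesis
      unfolding c_def by (intro not_rigid_if_invariant[where d = ?d, OF irr mem _ _ mem])
  qed
qed

text \<open>\<open>L\<close> and \<open>M\<close> are multiples of one matrix and transform alike,
  so the ratio of \<open>x 0\<close> to \<open>x 1\<close> is constant on the orbit. If both are
  zero there is no such ratio, but the structure is then a form.\<close>

lemma not_rigid_nilp: "\<not> rigid_in PermVar (nilp x)"
proof (cases "x 0 = 0 \<and> x 1 = 0")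
  case True
  have "nilp x = forms 4 ((\<lambda>_. 0)(0 := x 2 * (x 4 * x 4), 1 := x 2 * (x 4 * x 3), 2 := x 2 * (x 3 * x 4), 3 := x 2 * (x 3 * x 3)))"
    unfolding nilp_def forms_def by (rule mk_eqI) (auto simp: True form_idx_def)
  thus ?thesis using not_rigid_forms by simp
next
  case False
  let ?p = "\<lambda>d :: sstruct. x 1 * d 0 1 2 - x 0 * d 1 0 2"
  have p: "?p \<in> polyfun" by (intro pf_intros)
  have orb: "?p d = 0" if d: "d \<in> orbit (nilp x)" for d
  proof -
    obtain G H where GH: "gl_pair G H" "d = act G H (nilp x)" using d by (auto simp: orbit_def)
    show ?thesis unfolding GH(2) nilp_def act_mk[OF GH(1)] by (simp add: mk_simps algebra_simps)
  qed
  have irr: "zirreducible (zclosure (range nilp))" "zclosure (range nilp) \<subseteq> PermVar"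
    by (rule zirreducible_comps comps_subset, simp add: comps_def)+
  have mem: "nilp y \<in> zclosure (range nilp)" for y by (rule mem_zclosure_range)
  have "\<exists>y. ?p (nilp y) \<noteq> 0"
  proof (cases "x 1 = 0")
    case True
    hence "?p (nilp ((\<lambda>_. 1)(0 := 0))) \<noteq> 0" using False by (simp add: nilp_def nilp_mat_def mk_simps)
    thus ?thesis by blast
  next
    case False
    hence "?p (nilp ((\<lambda>_. 1)(1 := 0))) \<noteq> 0" by (simp add: nilp_def nilp_mat_def mk_simps)
    thus ?thesis by blast
  qed
  then obtain y where "?p (nilp y) \<noteq> 0" ..
  thus ?thesis by (intro not_rigid_if_invariant[where p = ?p and d = "nilp y", OF irr mem p _ mem]) (rule orb)
qed

lemma rigid_orbits: "{orbit c | c. rigid_in PermVar c} = (\<lambda>t. orbit (un t)) ` cone_types"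
proof (intro set_eqI iffI)
  fix X assume "X \<in> {orbit c | c. rigid_in PermVar c}"
  then obtain c where c: "rigid_in PermVar c" "X = orbit c" by auto
  hence V: "c \<in> PermVar" by (simp add: rigid_in_def)
  hence "c 0 0 0 \<noteq> 0" using classification[OF V] c not_rigid_forms not_rigid_nilp by blast
  then obtain t where "t \<in> cone_types" "c \<in> orbit (un t)" using mem_orbit_un V by blast
  thus "X \<in> (\<lambda>t. orbit (un t)) ` cone_types"
    using orbit_eq[OF un_StructSpace] c(2) by blast
qed (use rigid_un in blast)

lemma card_rigid_orbits: "card {orbit c | c. rigid_in PermVar c} = 6"
proof -
  have "inj_on (\<lambda>t. orbit (un t)) cone_types"
  proof (rule inj_onI)
    fix t t' assume t: "t \<in> cone_types" "t' \<in> cone_types" "orbit (un t) = orbit (un t')"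
    hence "zclosure (range (cn t)) = zclosure (range (cn t'))" by (metis zclosure_orbit_un)
    thus "t = t'" using cn_subset_imp_eq t by blast
  qed
  thus ?thesis unfolding rigid_orbits by (simp add: card_image card_cone_types)
qed

section \<open>Dimension\<close>

lemma mk_cong_below_4:
  "cn t x = cn t (\<lambda>i. if i < 4 then x i else 1)" "forms 4 x = forms 4 (\<lambda>i. if i < 4 then x i else 1)"
proof -
  let ?y = "\<lambda>i. if i < 4 then x i else 1"
  show "cn t x = cn t ?y"
    by (cases t) (auto simp: cn_def cone_def cone_s_def cone_mat_def intro!: mk_eqI)
  show "forms 4 x = forms 4 ?y"
    unfolding forms_def by (rule mk_eqI) (auto simp: form_idx_def)
qed

lemma comps_slice:
  assumes "X \<in> comps"
  shows "\<exists>g. polymap g \<and> X \<subseteq> zclosure (g ` {x. \<forall>i\<ge>4. x i = 1})"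
proof -
  let ?A = "{x :: nat \<Rightarrow> complex. \<forall>i\<ge>4. x i = 1}"
  have A: "(\<lambda>i. if i < 4 then x i else 1) \<in> ?A" for x by auto
  have 0: "zclosure (range g) \<subseteq> zclosure (g ` ?A)"
    if g: "polymap g" "\<And>x. g x = g (\<lambda>i. if i < 4 then x i else 1)" for g
  proof (rule zclosure_mono)
    show "range g \<subseteq> g ` ?A" by (rule image_subsetI) (rule image_eqI[where f = g, OF g(2) A])
    show "g ` ?A \<subseteq> StructSpace" by (rule range_polymap[OF g(1)])
  qed
  note 1 = 0[OF polymap_cn mk_cong_below_4(1)] and 2 = 0[OF polymap_forms mk_cong_below_4(2)]
  have 3: "zclosure (nilp ` ?A) = zclosure (range nilp)"
  proof (rule zclosure_dense[OF polymap_nilp mpf_coord, of "\<lambda>_. 1" 4])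
    show "nilp ` {x. x 4 \<noteq> 0} \<subseteq> nilp ` ?A"
    proof
      fix c assume "c \<in> nilp ` {x. x 4 \<noteq> 0}"
      then obtain x where x: "c = nilp x" "x 4 \<noteq> 0" by auto
      \<comment> \<open>Dividing the linear form by \<open>x 4\<close> is compensated by the factor
        \<open>x 4 ^ 2\<close> in the other parameters, as the structure is quadratic in the
        form.\<close>
      define y :: "nat \<Rightarrow> complex" where "y = (\<lambda>_. 1)(0 := x 0 * x 4 ^ 2, 1 := x 1 * x 4 ^ 2, 2 := x 2 * x 4 ^ 2, 3 := x 3 / x 4)"
      have "c = nilp y" unfolding x(1) nilp_def nilp_mat_def
        by (rule mk_eqI) (use x(2) in \<open>auto simp: y_def field_simps power2_eq_square\<close>)
      moreover have "y \<in> ?A" by (simp add: y_def)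
      ultimately show "c \<in> nilp ` ?A" by blast
    qed
  qed auto
  show ?thesis using assms unfolding comps_def
  proof (elim insertE imageE)
    show ?thesis if "X = zclosure (range (forms 4))"
      unfolding that by (intro exI[of _ "forms 4"] conjI polymap_forms 2)
    show ?thesis if "X = zclosure (range nilp)"
      unfolding that 3[symmetric] by (intro exI[of _ nilp] conjI polymap_nilp order_refl)
    show ?thesis if "X = zclosure (range (cn t))" for t
      unfolding that by (intro exI[of _ "cn t"] conjI polymap_cn 1)
  qed
qed

text \<open>A longer chain is cut after its sixth set, which by irreducibility lies in a single
  component and hence in the closure of an image of affine 4-space.\<close>

lemma chain_bound:
  assumes Z: "\<forall>i\<le>n. zirreducible (Z i) \<and> Z i \<subseteq> PermVar" "\<forall>i<n. Z i \<subset> Z (Suc i)"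
  shows "n \<le> 4"
proof (rule ccontr)
  assume "\<not> n \<le> 4"
  hence n: "5 \<le> n" by simp
  have "\<exists>X\<in>comps. Z 5 \<subseteq> X"
    by (rule zirreducible_Union)
      (use Z(1) n Union_comps zirreducible_comps in \<open>auto simp: comps_def finite_cone_types zirreducible_def\<close>)
  then obtain g where "polymap g" "Z 5 \<subseteq> zclosure (g ` {x. \<forall>i\<ge>4. x i = 1})"
    using comps_slice by blast
  thus False using no_chain_of_length_5[of Z g] Z n by auto
qed

lemma forms_chain:
  assumes "i < 4"
  shows "zclosure (range (forms i)) \<subset> zclosure (range (forms (Suc i)))"
proof -
  have eq: "forms i x = forms (Suc i) (\<lambda>k. if k < i then x k else 0)" for x
    unfolding forms_def by (rule mk_eqI) auto
  have "range (forms i) \<subseteq> range (forms (Suc i))" by (rule image_subsetI) (metis eq rangeI)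
  hence sub: "zclosure (range (forms i)) \<subseteq> zclosure (range (forms (Suc i)))"
    by (rule zclosure_mono) (rule range_polymap[OF polymap_forms])
  have "\<exists>r s. r \<in> {1,2} \<and> s \<in> {1,2} \<and> form_idx r s = i"
  proof -
    have "form_idx 1 1 = 0" "form_idx 1 2 = 1" "form_idx 2 1 = 2" "form_idx 2 2 = 3"
      by (simp_all add: form_idx_def)
    moreover have "i = 0 \<or> i = 1 \<or> i = 2 \<or> i = 3" using assms by linarith
    ultimately show ?thesis by (metis insertI1 insertI2)
  qed
  then obtain r s where rs: "r \<in> {1,2}" "s \<in> {1,2}" "form_idx r s = i" by blast
  have val: "forms n x r s 0 = (if i < n then x i else 0)" for n x
    using rs by (auto simp: forms_def mk_simps)
  let ?c = "forms (Suc i) (\<lambda>_. 1)"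
  have "?c \<notin> zclosure (range (forms i))"
  proof
    assume "?c \<in> zclosure (range (forms i))"
    hence "?c r s 0 = 0"
      by (rule zclosure_range_vanish[OF polymap_forms pf_coord, rotated]) (simp add: val)
    thus False by (simp add: val)
  qed
  moreover have "?c \<in> zclosure (range (forms (Suc i)))" by (rule mem_zclosure_range)
  ultimately show ?thesis using sub by (auto simp: psubset_eq)
qed

lemma zdim_PermVar: "zdim PermVar = 4"
proof (rule antisym)
  show "zdim PermVar \<le> 4"
    unfolding zdim_def
  proof (rule Sup_least)
    fix m assume "m \<in> {enat n | n. \<exists>Z :: nat \<Rightarrow> sstruct set.
      (\<forall>i\<le>n. zirreducible (Z i) \<and> Z i \<subseteq> PermVar) \<and> (\<forall>i<n. Z i \<subset> Z (Suc i))}"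
    then obtain n where "m = enat n" "n \<le> 4" using chain_bound by blast
    thus "m \<le> 4" by (metis enat_ord_simps(1) numeral_eq_enat)
  qed
  have "zirreducible (zclosure (range (forms i))) \<and> zclosure (range (forms i)) \<subseteq> PermVar" for i
    using zirreducible_polymap[OF polymap_forms] forms_in_PermVar
    by (auto intro!: zclosure_least[OF zclosed_PermVar])
  hence "enat 4 \<le> zdim PermVar"
    unfolding zdim_def
    by (intro Sup_upper CollectI exI[of _ "4::nat"] exI[of _ "\<lambda>i. zclosure (range (forms i))"] conjI refl)
      (use forms_chain in auto)
  thus "4 \<le> zdim PermVar" by (simp add: numeral_eq_enat)
qed

theorem mainTheorem7:
  shows "zdim PermVar = 4 \<and>
    irr_components PermVar =
      {zclosure (\<Union>\<alpha>. orbit (R04 \<alpha>)), zclosure (\<Union>\<alpha>. orbit (R07 \<alpha>)),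
       zclosure (orbit R09), zclosure (orbit R15), zclosure (orbit R17),
       zclosure (orbit R19), zclosure (orbit R22), zclosure (orbit R24)} \<and>
    card (irr_components PermVar) = 8 \<and>
    card {orbit c | c. rigid_in PermVar c} = 6"
proof -
  have "R09 = un (0,0,1,0)" "R15 = un (1,0,1,1)" "R17 = un (1,0,1,0)"
    "R19 = un (0,0,0,0)" "R22 = un (0,0,1,1)" "R24 = un (1,1,1,1)"
    by (simp_all add: un_def tbl_eq_mk)
  note R = this
  have "comps = {zclosure (\<Union>\<alpha>. orbit (R04 \<alpha>)), zclosure (\<Union>\<alpha>. orbit (R07 \<alpha>)),
       zclosure (orbit R09), zclosure (orbit R15), zclosure (orbit R17),
       zclosure (orbit R19), zclosure (orbit R22), zclosure (orbit R24)}"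
    unfolding comps_def cone_types_def by (simp only: R zclosure_orbits_R04 zclosure_orbits_R07 zclosure_orbit_un
        image_insert image_empty)
  thus ?thesis
    using zdim_PermVar irr_components_PermVar card_comps card_rigid_orbits by simp
qed

end
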